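(* Let $X$ and $Y$ be $\sigma$-finite measure spaces, let $L\subset\mathcal M(X)$ be a regular class, let $T:L\to\mathcal M(Y)$ be an order continuous sublinear operator, and let $0<q_0\le 1$, $0<p_0<\infty$. Then: (a) If $q_0\le q_1\le p_1<\infty$, $$\sup_{f\in L}\frac{\|Tf\|_{L^{p_1,q_1}(Y)}}{\|f\|_{L^{p_0,q_0}(X)}}=\sup_{\chi_B\in L}\frac{\|T\chi_B\|_{L^{p_1,q_1}(Y)}}{\|\chi_B\|_{L^{p_0,q_0}(X)}}.$$ (b) If $q_0<p_1<q_1\le\infty$, $$\sup_{f\in L}\frac{\|Tf\|_{L^{p_1,q_1}(Y)}}{\|f\|_{L^{p_0,q_0}(X)}}\le\Big(\frac{p_1}{p_1-q_0}\Big)^{1/q_0}\sup_{\chi_B\in L}\frac{\|T\chi_B\|_{L^{p_1,q_1}(Y)}}{\|\chi_B\|_{L^{p_0,q_0}(X)}}.$$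
   Context: $\mathcal M(X)$ is the set of measurable functions on $(X,\mu)$. For $f\in\mathcal M(X)$, $\lambda_f(t)=\mu(\{|f|>t\})$, $f^*(t)=\inf\{s>0:\lambda_f(s)\le t\}$, and for $0<p,q<\infty$, $\|f\|_{L^{p,q}(X)}=\big(\int_0^\infty (t^{1/p}f^*(t))^q\,\frac{dt}{t}\big)^{1/q}$, with $\|f\|_{L^{p,\infty}(X)}=\sup_{t>0}t^{1/p}f^*(t)$. Undetermined expressions $0\cdot\infty$, $\infty/\infty$, $0/0$ are taken equal to $0$. The suprema "over $\chi_B\in L$" are over all measurable sets $B\subset X$ with $\chi_B\in L$. Regular class: a nonempty $L\subset\mathcal M(X)$ is a regular class in $X$ if for every $f\in L$: (i) $|\alpha f|\in L$ for every $\alpha\in\mathbb R$; (ii) $\chi_{\{|f|>t\}}\in L$ for every $t>0$; (iii) there is a sequence of simple functions $(f_n)_n\subset L$ with $0\le f_n(x)\le f_{n+1}(x)\to|f(x)|$ a.e. $x\in X$. An operator $T:L\to\mathcal M(Y)$ is sublinear if $|T(\alpha_1f_1+\dots+\alpha_nf_n)(y)|\le|\alpha_1Tf_1(y)|+\dots+|\alpha_nTf_n(y)|$ a.e. $y\in Y$ for all $\alpha_i\in\mathbb R$ and $f_i\in L$ such that $\alpha_1f_1+\dots+\alpha_nf_n\in L$. It is monotone if $|Tf(y)|\le|Tg(y)|$ a.e. $y$ whenever $f,g\in L$ and $|f(x)|\le|g(x)|$ a.e. $x$. It is order continuous if it is monotone and, for every sequence $(f_n)_n\subset L$ with $0\le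 f_n(x)\le f_{n+1}(x)\to f(x)$ a.e. $x$, $f\in L$, one has $\lim_n|Tf_n(y)|=|Tf(y)|$ a.e. $y\in Y$. *)

theory Defs
  imports "HOL-Analysis.Analysis"
begin

text \<open>
  Functions on \<open>X\<close> are real-valued. A HOL function is defined on the whole type, so its values
  off \<^term>\<open>space X\<close> are pinned to 0: members then correspond one-to-one to measurable
  functions on the set \<^term>\<open>space X\<close>. Sums, absolute values, scalar multiples and
  indicators of measurable sets all respect this convention. Functions that agree only almost
  everywhere are not identified.
\<close>

definition measurable_functions :: "'a measure \<Rightarrow> ('a \<Rightarrow> real) set" where
  "measurable_functions X = {f \<in> borel_measurable X. \<forall>x. x \<notin> space X \<longrightarrow> f x = 0}"

definition distribution_function :: "'a measure \<Rightarrow> ('a \<Rightarrow> real) \<Rightarrow> real \<Rightarrow> ennreal" where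
  "distribution_function X f t = emeasure X {x \<in> space X. \<bar>f x\<bar> > t}"

text \<open>The value is \<open>\<infinity>\<close> when no level \<open>s\<close> qualifies, since \<^term>\<open>Inf {} = (top :: ennreal)\<close>.\<close>

definition decreasing_rearrangement :: "'a measure \<Rightarrow> ('a \<Rightarrow> real) \<Rightarrow> real \<Rightarrow> ennreal" where
  "decreasing_rearrangement X f t =
     Inf {ennreal s | s. s > 0 \<and> distribution_function X f s \<le> ennreal t}"

text \<open>Powers of extended nonnegative numbers, meaningful for exponents \<open>a > 0\<close> only.\<close>

definition ennreal_powr :: "ennreal \<Rightarrow> real \<Rightarrow> ennreal" where
  "ennreal_powr x a = (if x = top then top else ennreal (enn2real x powr a))"

definition lorentz_norm :: "'a measure \<Rightarrow> real \<Rightarrow> ennreal \<Rightarrow> ('a \<Rightarrow> real) \<Rightarrow> ennreal" where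
  "lorentz_norm X p q f =
     (if q = top
      then SUP t\<in>{0<..}. ennreal (t powr (1 / p)) * decreasing_rearrangement X f t
      else ennreal_powr
        (\<integral>\<^sup>+t\<in>{0<..}. (ennreal_powr
             (ennreal (t powr (1 / p)) * decreasing_rearrangement X f t) (enn2real q)
             / ennreal t) \<partial>lborel)
        (1 / enn2real q))"

definition regular_class :: "'a measure \<Rightarrow> ('a \<Rightarrow> real) set \<Rightarrow> bool" where
  "regular_class X L \<longleftrightarrow>
     L \<noteq> {} \<and> L \<subseteq> measurable_functions X \<and>
     (\<forall>f\<in>L.
        (\<forall>\<alpha>::real. (\<lambda>x. \<bar>\<alpha> * f x\<bar>) \<in> L) \<and>
        (\<forall>t>0. indicator {x \<in> space X. \<bar>f x\<bar> > t} \<in> L) \<and>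
        (\<exists>fs :: nat \<Rightarrow> 'a \<Rightarrow> real.
           (\<forall>n. fs n \<in> L \<and> simple_function X (fs n)) \<and>
           (AE x in X. (\<forall>n. 0 \<le> fs n x \<and> fs n x \<le> fs (Suc n) x) \<and>
                       (\<lambda>n. fs n x) \<longlonglongrightarrow> \<bar>f x\<bar>)))"

text \<open>
  In the following predicates \<open>T\<close> is a total HOL function, but only its values on \<open>L\<close> are
  constrained.
\<close>

definition sublinear_op ::
  "('a \<Rightarrow> real) set \<Rightarrow> 'b measure \<Rightarrow> (('a \<Rightarrow> real) \<Rightarrow> 'b \<Rightarrow> real) \<Rightarrow> bool" where
  "sublinear_op L Y T \<longleftrightarrow>
     (\<forall>n\<ge>1. \<forall>(\<alpha> :: nat \<Rightarrow> real) fs.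
        (\<forall>i<n. fs i \<in> L) \<longrightarrow> (\<lambda>x. \<Sum>i<n. \<alpha> i * fs i x) \<in> L \<longrightarrow>
        (AE y in Y. \<bar>T (\<lambda>x. \<Sum>i<n. \<alpha> i * fs i x) y\<bar> \<le> (\<Sum>i<n. \<bar>\<alpha> i * T (fs i) y\<bar>)))"

definition monotone_op ::
  "'a measure \<Rightarrow> ('a \<Rightarrow> real) set \<Rightarrow> 'b measure \<Rightarrow> (('a \<Rightarrow> real) \<Rightarrow> 'b \<Rightarrow> real) \<Rightarrow> bool" where
  "monotone_op X L Y T \<longleftrightarrow>
     (\<forall>f\<in>L. \<forall>g\<in>L. (AE x in X. \<bar>f x\<bar> \<le> \<bar>g x\<bar>) \<longrightarrow> (AE y in Y. \<bar>T f y\<bar> \<le> \<bar>T g y\<bar>))"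

definition order_continuous_op ::
  "'a measure \<Rightarrow> ('a \<Rightarrow> real) set \<Rightarrow> 'b measure \<Rightarrow> (('a \<Rightarrow> real) \<Rightarrow> 'b \<Rightarrow> real) \<Rightarrow> bool" where
  "order_continuous_op X L Y T \<longleftrightarrow>
     monotone_op X L Y T \<and>
     (\<forall>(fs :: nat \<Rightarrow> 'a \<Rightarrow> real). \<forall>f\<in>L.
        (\<forall>n. fs n \<in> L) \<longrightarrow>
        (AE x in X. (\<forall>n. 0 \<le> fs n x \<and> fs n x \<le> fs (Suc n) x) \<and> (\<lambda>n. fs n x) \<longlonglongrightarrow> f x) \<longrightarrow>
        (AE y in Y. (\<lambda>n. \<bar>T (fs n) y\<bar>) \<longlonglongrightarrow> \<bar>T f y\<bar>))"

text \<open>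
  The conventions \<open>0 / 0 = 0\<close>, \<open>\<infinity> / \<infinity> = 0\<close> and \<open>0 \<cdot> \<infinity> = 0\<close> needed for quotients of norms
  are those of the type \<^typ>\<open>ennreal\<close>:
\<close>

lemma ennreal_indeterminate:
  "(0 :: ennreal) / 0 = 0" "(top :: ennreal) / top = 0" "(0 :: ennreal) * top = 0"
  by simp_all

end

theory Submission
  imports Defs
begin

text \<open>
  Split a nonnegative simple \<open>g \<in> L\<close> along its levels \<open>0 = a\<^sub>0 < a\<^sub>1 < \<dots>\<close> into multiples of the
  indicators of \<open>A\<^sub>j = {a\<^sub>j\<^sub>+\<^sub>1 \<le> g}\<close>. By monotonicity of \<open>T\<close> the functions \<open>\<bar>T \<chi>(A\<^sub>j)\<bar>\<close> decrease
  in \<open>j\<close>, and for \<open>q\<^sub>0 \<le> 1\<close> this upgrades sublinearity to the pointwise bound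
  \<open>\<bar>T g\<bar>\<^sup>q \<le> \<Sum>\<^sub>j (a\<^sub>j\<^sub>+\<^sub>1\<^sup>q - a\<^sub>j\<^sup>q) \<bar>T \<chi>(A\<^sub>j)\<bar>\<^sup>q\<close> with \<open>q = q\<^sub>0\<close>. The same weights reproduce at most
  \<open>\<parallel>g\<parallel>\<^sup>q\<close> in \<open>L(p\<^sub>0, q\<^sub>0)\<close>. Taking the \<open>q\<^sub>0\<close>-th power turns \<open>L(p\<^sub>1, q\<^sub>1)\<close> into
  \<open>L(p\<^sub>1/q\<^sub>0, q\<^sub>1/q\<^sub>0)\<close>, which for \<open>q\<^sub>1 \<le> p\<^sub>1\<close> satisfies the triangle inequality and for
  \<open>p\<^sub>1 < q\<^sub>1\<close> satisfies it for the averaged rearrangement, at the price of Hardy's constant.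
  Order continuity passes from simple functions to all of \<open>L\<close>.
\<close>

section \<open>Powers in the extended nonnegative reals\<close>

text \<open>The upgrade for \<open>q\<^sub>0 \<le> 1\<close> is concavity of the power: the larger
  the sum already collected, the less its \<open>q\<^sub>0\<close>-th power gains from one more
  layer. The number of layers is unbounded, so a quasi-triangle inequality whose constant is paid at
  every addition would be useless. For \<open>p\<^sub>1 < q\<^sub>1\<close> all layers are therefore
  added at the level of averaged rearrangements, which are subadditive, and Hardy's inequality is
  paid once. With \<open>p = p\<^sub>1 / q\<^sub>0\<close> its constant \<open>p / (p - 1)\<close>
  is \<open>p\<^sub>1 / (p\<^sub>1 - q\<^sub>0)\<close>, and undoing the \<open>q\<^sub>0\<close>-th
  power produces the exponent \<open>1 / q\<^sub>0\<close>. For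
  \<open>q\<^sub>1 \<le> p\<^sub>1\<close> the weight
  \<open>t powr (q\<^sub>1 / p\<^sub>1 - 1)\<close> is decreasing, hence a mixture of indicators of
  initial segments, over each of which the integral of the rearrangement is subadditive. This gives
  constant 1. The conventions for quotients do no harm: each layer enters with a positive weight, so
  the layers of a function of finite norm have finite norm themselves.\<close>

lemma ennreal_le_via_less:
  fixes x y :: ennreal
  assumes "\<And>s. 0 \<le> s \<Longrightarrow> ennreal s < x \<Longrightarrow> ennreal s < y"
  shows "x \<le> y"
proof (rule ccontr)
  assume "\<not> x \<le> y"
  then obtain z where z: "y < z" "z < x" using dense[of y x] by (auto simp: not_le)
  obtain s where "0 \<le> s" "z = ennreal s" using z by (cases z) auto
  with z assms[of s] show False by auto
qed

lemma ennreal_powr_ennreal [simp]: "0 \<le> r \<Longrightarrow> ennreal_powr (ennreal r) a = ennreal (r powr a)"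
  by (simp add: ennreal_powr_def)

lemma ennreal_powr_top [simp]: "ennreal_powr top a = top"
  by (simp add: ennreal_powr_def)

lemma ennreal_powr_0 [simp]: "ennreal_powr 0 a = 0"
  by (simp add: ennreal_powr_def)

lemma ennreal_powr_one [simp]: "ennreal_powr x 1 = x"
  by (cases x) auto

lemma ennreal_powr_powr: "ennreal_powr (ennreal_powr x a) b = ennreal_powr x (a * b)"
  by (cases x) (auto simp: powr_powr)

lemma ennreal_powr_mono: "0 \<le> a \<Longrightarrow> x \<le> y \<Longrightarrow> ennreal_powr x a \<le> ennreal_powr y a"
  by (cases x; cases y) (auto simp: powr_mono2 top_unique)

lemma ennreal_powr_mult:
  assumes "0 < a"
  shows "ennreal_powr (x * y) a = ennreal_powr x a * ennreal_powr y a"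
proof (cases "x = 0 \<or> y = 0")
  case False
  then show ?thesis using assms
    by (cases x; cases y)
      (auto simp: powr_mult ennreal_mult[symmetric] ennreal_mult_top ennreal_top_mult)
qed auto

lemma ennreal_powr_le_iff:
  assumes "0 < a"
  shows "ennreal_powr x a \<le> y \<longleftrightarrow> x \<le> ennreal_powr y (1 / a)"
proof
  assume "ennreal_powr x a \<le> y"
  from ennreal_powr_mono[OF _ this, of "1 / a"] show "x \<le> ennreal_powr y (1 / a)"
    using assms by (simp add: ennreal_powr_powr)
next
  assume "x \<le> ennreal_powr y (1 / a)"
  from ennreal_powr_mono[OF _ this, of a] show "ennreal_powr x a \<le> y"
    using assms by (simp add: ennreal_powr_powr)
qed

lemma less_ennreal_powr_iff:
  assumes "0 < a" "0 \<le> s"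
  shows "ennreal s < ennreal_powr x a \<longleftrightarrow> ennreal (s powr (1 / a)) < x"
  using ennreal_powr_le_iff[OF assms(1), of x "ennreal s"] assms
  by (simp flip: not_le)

text \<open>By \<open>ennreal_powr_le_iff\<close> the power is a lower adjoint, and lower adjoints
  preserve suprema.\<close>

lemma ennreal_powr_SUP:
  assumes "0 < a"
  shows "ennreal_powr (SUP i\<in>I. x i) a = (SUP i\<in>I. ennreal_powr (x i) a)"
proof (rule antisym)
  have "x i \<le> ennreal_powr (SUP i\<in>I. ennreal_powr (x i) a) (1 / a)" if "i \<in> I" for i
    using that by (subst ennreal_powr_le_iff[OF assms, symmetric]) (rule SUP_upper)
  then show "ennreal_powr (SUP i\<in>I. x i) a \<le> (SUP i\<in>I. ennreal_powr (x i) a)"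
    by (subst ennreal_powr_le_iff[OF assms]) (rule SUP_least)
  show "(SUP i\<in>I. ennreal_powr (x i) a) \<le> ennreal_powr (SUP i\<in>I. x i) a"
    using assms by (intro SUP_least ennreal_powr_mono SUP_upper) auto
qed

lemma borel_measurable_ennreal_powr [measurable (raw)]:
  assumes "f \<in> borel_measurable M"
  shows "(\<lambda>x. ennreal_powr (f x) a) \<in> borel_measurable M"
  unfolding ennreal_powr_def using assms by measurable

section \<open>Distribution functions and decreasing rearrangements\<close>

lemma distribution_function_antimono:
  assumes [measurable]: "f \<in> borel_measurable X" and "s \<le> t"
  shows "distribution_function X f t \<le> distribution_function X f s"
  unfolding distribution_function_def using assms(2) by (intro emeasure_mono) auto

lemma distribution_function_mono:
  assumes [measurable]: "f \<in> borel_measurable X" "g \<in> borel_measurable X"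
    and "AE x in X. \<bar>f x\<bar> \<le> \<bar>g x\<bar>"
  shows "distribution_function X f s \<le> distribution_function X g s"
  unfolding distribution_function_def using assms(3) by (intro emeasure_mono_AE) auto

text \<open>This is continuity from below of the measure along growing superlevel sets, so it also
  holds where the measure is infinite.\<close>

lemma distribution_function_right_cont:
  assumes [measurable]: "f \<in> borel_measurable X"
  shows "distribution_function X f s = (SUP n. distribution_function X f (s + 1 / Suc n))"
proof -
  have "(SUP n. emeasure X {x \<in> space X. \<bar>f x\<bar> > s + 1 / Suc n})
      = emeasure X (\<Union>n. {x \<in> space X. \<bar>f x\<bar> > s + 1 / Suc n})"
  proof (rule SUP_emeasure_incseq)
    show "incseq (\<lambda>n. {x \<in> space X. s + 1 / real (Suc n) < \<bar>f x\<bar>})"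
    proof (rule incseq_SucI, safe)
      fix n x assume "s + 1 / real (Suc n) < \<bar>f x\<bar>"
      moreover have "1 / real (Suc (Suc n)) \<le> 1 / real (Suc n)" by (simp add: frac_le)
      ultimately show "s + 1 / real (Suc (Suc n)) < \<bar>f x\<bar>" by linarith
    qed
  qed auto
  also have "(\<Union>n. {x \<in> space X. \<bar>f x\<bar> > s + 1 / Suc n}) = {x \<in> space X. \<bar>f x\<bar> > s}"
  proof (safe)
    fix n x assume "s + 1 / real (Suc n) < \<bar>f x\<bar>"
    moreover have "0 < 1 / real (Suc n)" by simp
    ultimately show "s < \<bar>f x\<bar>" by linarith
  next
    fix x assume "x \<in> space X" "s < \<bar>f x\<bar>"
    then obtain n where "1 / real (Suc n) < \<bar>f x\<bar> - s"
      using nat_approx_posE[of "\<bar>f x\<bar> - s"] by auto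
    then show "x \<in> (\<Union>n. {x \<in> space X. s + 1 / real (Suc n) < \<bar>f x\<bar>})"
      using \<open>x \<in> space X\<close> by (auto intro!: exI[of _ n])
  qed
  finally show ?thesis by (simp add: distribution_function_def)
qed

text \<open>The rearrangement is a generalised inverse of the distribution function; right
  continuity of the latter allows strict inequalities on both sides. Later identities for
  rearrangements are proved by rewriting \<open>ennreal s < \<dots>\<close> with this equivalence
  and concluding with \<open>ennreal_le_via_less\<close>.\<close>

lemma less_rearrangement_iff:
  assumes f: "f \<in> borel_measurable X" and "0 \<le> s"
  shows "ennreal s < decreasing_rearrangement X f t \<longleftrightarrow> ennreal t < distribution_function X f s"
proof
  assume *: "ennreal s < decreasing_rearrangement X f t"
  show "ennreal t < distribution_function X f s"
  proof (rule ccontr)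
    assume "\<not> ennreal t < distribution_function X f s"
    then have le: "distribution_function X f s \<le> ennreal t" by simp
    have "decreasing_rearrangement X f t \<le> ennreal s"
    \<comment> \<open>The infimum ranges over positive levels only, so \<open>s\<close> itself is
      not admissible when \<open>s = 0\<close>; the level \<open>s + e\<close> always is.\<close>
    proof (rule ennreal_le_epsilon)
      fix e :: real assume "0 < e"
      have "distribution_function X f (s + e) \<le> distribution_function X f s"
        using \<open>0 < e\<close> by (intro distribution_function_antimono f) simp
      also note le
      finally have "distribution_function X f (s + e) \<le> ennreal t" .
      then have "decreasing_rearrangement X f t \<le> ennreal (s + e)"
        unfolding decreasing_rearrangement_def using \<open>0 < e\<close> \<open>0 \<le> s\<close>
        by (intro Inf_lower CollectI exI[of _ "s + e"] conjI refl) simp_all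
      also have "\<dots> = ennreal s + ennreal e"
        using \<open>0 < e\<close> \<open>0 \<le> s\<close> by (intro ennreal_plus) auto
      finally show "decreasing_rearrangement X f t \<le> ennreal s + ennreal e" .
    qed
    with * show False by simp
  qed
next
  assume "ennreal t < distribution_function X f s"
  also note distribution_function_right_cont[OF f]
  finally obtain n where n: "ennreal t < distribution_function X f (s + 1 / Suc n)"
    by (rule less_SUP_iff[THEN iffD1, THEN bexE])
  have "ennreal (s + 1 / Suc n) \<le> decreasing_rearrangement X f t"
    unfolding decreasing_rearrangement_def
  proof (safe intro!: Inf_greatest ennreal_leI)
    fix r assume r: "distribution_function X f r \<le> ennreal t"
    show "s + 1 / real (Suc n) \<le> r"
    proof (rule ccontr)
      assume "\<not> s + 1 / real (Suc n) \<le> r"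
      then have "distribution_function X f (s + 1 / Suc n) \<le> distribution_function X f r"
        by (intro distribution_function_antimono f) simp
      also note r
      finally show False using n by simp
    qed
  qed
  moreover have "ennreal s < ennreal (s + 1 / Suc n)"
    using \<open>0 \<le> s\<close> by (intro ennreal_lessI add_nonneg_pos) auto
  ultimately show "ennreal s < decreasing_rearrangement X f t" by (metis order_less_le_trans)
qed

lemma rearrangement_antimono:
  "s \<le> t \<Longrightarrow> decreasing_rearrangement X f t \<le> decreasing_rearrangement X f s"
  unfolding decreasing_rearrangement_def
  by (intro Inf_superset_mono) (blast intro: order_trans ennreal_leI)

lemma rearrangement_mono:
  assumes "f \<in> borel_measurable X" "g \<in> borel_measurable X" "AE x in X. \<bar>f x\<bar> \<le> \<bar>g x\<bar>"
  shows "decreasing_rearrangement X f t \<le> decreasing_rearrangement X g t"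
  using distribution_function_mono[OF assms]
  by (intro ennreal_le_via_less) (auto simp: less_rearrangement_iff assms intro: order_less_le_trans)

lemma borel_measurable_rearrangement [measurable]:
  "decreasing_rearrangement X f \<in> borel_measurable borel"
proof (rule borel_measurableI_greater)
  fix y
  have "is_interval {t. y < decreasing_rearrangement X f t}"
    unfolding is_interval_1 using rearrangement_antimono[of _ _ X f]
    by (auto intro: order_less_le_trans)
  then show "{x \<in> space borel. y < decreasing_rearrangement X f x} \<in> sets borel"
    by (simp add: real_interval_borel_measurable)
qed

lemma borel_measurable_rearrangement' [measurable (raw)]:
  "g \<in> borel_measurable M \<Longrightarrow> (\<lambda>t. decreasing_rearrangement X f (g t)) \<in> borel_measurable M"
  by (rule measurable_compose[OF _ borel_measurable_rearrangement])

text \<open>A level strictly below the rearrangement of the limit means that \<open>t\<close> is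
  strictly below the measure of a superlevel set, and this strict inequality is already reached
  along the sequence. The superlevel sets increase only almost everywhere, so the limit of their
  measures is taken through integrals of indicators.\<close>

lemma rearrangement_SUP:
  assumes fs: "\<And>n. fs n \<in> borel_measurable X" and f: "f \<in> borel_measurable X"
    and "AE x in X. \<forall>n. \<bar>fs n x\<bar> \<le> \<bar>fs (Suc n) x\<bar>"
    and "AE x in X. (\<lambda>n. \<bar>fs n x\<bar>) \<longlonglongrightarrow> \<bar>f x\<bar>"
  shows "decreasing_rearrangement X f t = (SUP n. decreasing_rearrangement X (fs n) t)"
proof (rule antisym)
  note [measurable] = fs f
  have AE: "AE x in X. incseq (\<lambda>n. \<bar>fs n x\<bar>) \<and> (\<lambda>n. \<bar>fs n x\<bar>) \<longlonglongrightarrow> \<bar>f x\<bar>"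
    using assms(3,4) by eventually_elim (auto intro: incseq_SucI)
  have "AE x in X. \<bar>fs n x\<bar> \<le> \<bar>f x\<bar>" for n
    using AE by eventually_elim (auto intro: incseq_le)
  then show "(SUP n. decreasing_rearrangement X (fs n) t) \<le> decreasing_rearrangement X f t"
    by (intro SUP_least rearrangement_mono fs f)
  show "decreasing_rearrangement X f t \<le> (SUP n. decreasing_rearrangement X (fs n) t)"
  proof (rule ennreal_le_via_less)
    fix s :: real assume s: "0 \<le> s" "ennreal s < decreasing_rearrangement X f t"
    define A where "A n = {x \<in> space X. \<bar>fs n x\<bar> > s}" for n
    have [measurable]: "A n \<in> sets X" for n unfolding A_def by measurable
    have "distribution_function X f s \<le> (SUP n. emeasure X (A n))"
    proof -
      have "distribution_function X f s = (\<integral>\<^sup>+x. indicator {x \<in> space X. \<bar>f x\<bar> > s} x \<partial>X)"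
        by (simp add: distribution_function_def)
      also have "\<dots> \<le> (\<integral>\<^sup>+x. (SUP n. indicator (A n) x) \<partial>X)"
      proof (rule nn_integral_mono_AE)
        show "AE x in X. indicator {x \<in> space X. s < \<bar>f x\<bar>} x \<le> (SUP n. indicator (A n) x :: ennreal)"
          using AE
        proof eventually_elim
          case (elim x)
          show ?case
          proof (cases "x \<in> space X \<and> s < \<bar>f x\<bar>")
            case True
            with elim have "eventually (\<lambda>n. s < \<bar>fs n x\<bar>) sequentially"
              by (auto simp: order_tendsto_iff)
            then obtain n where "s < \<bar>fs n x\<bar>" by (auto simp: eventually_sequentially)
            then show ?thesis using True by (intro SUP_upper2[of n]) (auto simp: A_def)
          qed auto
        qed
      qed
      also have "\<dots> = (SUP n. \<integral>\<^sup>+x. indicator (A n) x \<partial>X)"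
      proof (rule nn_integral_monotone_convergence_SUP_AE)
        show "AE x in X. indicator (A n) x \<le> (indicator (A (Suc n)) x :: ennreal)" for n
          using assms(3) by eventually_elim (auto simp: A_def indicator_def dest!: spec[of _ n])
      qed auto
      finally show ?thesis by simp
    qed
    moreover have "ennreal t < distribution_function X f s" using s by (simp add: less_rearrangement_iff f)
    ultimately have "ennreal t < (SUP n. emeasure X (A n))" by simp
    then obtain n where "ennreal t < emeasure X (A n)"
      by (auto simp: less_SUP_iff)
    then have "ennreal s < decreasing_rearrangement X (fs n) t"
      using s by (simp add: less_rearrangement_iff fs distribution_function_def A_def)
    then show "ennreal s < (SUP n. decreasing_rearrangement X (fs n) t)"
      by (rule order_less_le_trans) (rule SUP_upper, simp)
  qed
qed

section \<open>Rearrangements of powers, multiples and indicators\<close>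

lemma rearrangement_powr:
  assumes f: "f \<in> borel_measurable X" and "0 < a"
  shows "decreasing_rearrangement X (\<lambda>x. \<bar>f x\<bar> powr a) t = ennreal_powr (decreasing_rearrangement X f t) a"
proof -
  have [measurable]: "f \<in> borel_measurable X" by fact
  have "ennreal s < decreasing_rearrangement X (\<lambda>x. \<bar>f x\<bar> powr a) t \<longleftrightarrow>
        ennreal s < ennreal_powr (decreasing_rearrangement X f t) a" if "0 \<le> s" for s
  proof -
    have "(s < \<bar>f x\<bar> powr a) = (s powr (1 / a) < \<bar>f x\<bar>)" for x
      using less_ennreal_powr_iff[OF \<open>0 < a\<close> that, of "ennreal \<bar>f x\<bar>"] that by (simp add: ennreal_less_iff)
    then have "distribution_function X (\<lambda>x. \<bar>f x\<bar> powr a) s = distribution_function X f (s powr (1 / a))"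
      by (simp add: distribution_function_def)
    then show ?thesis using that
      by (simp add: less_ennreal_powr_iff \<open>0 < a\<close> less_rearrangement_iff f)
  qed
  then show ?thesis by (intro antisym ennreal_le_via_less) auto
qed

lemma rearrangement_cmult:
  assumes f: "f \<in> borel_measurable X" and "0 < c"
  shows "decreasing_rearrangement X (\<lambda>x. c * f x) t = ennreal c * decreasing_rearrangement X f t"
proof -
  have [measurable]: "f \<in> borel_measurable X" by fact
  have "ennreal s < decreasing_rearrangement X (\<lambda>x. c * f x) t \<longleftrightarrow>
        ennreal s < ennreal c * decreasing_rearrangement X f t" if "0 \<le> s" for s
  proof -
    have "(s < \<bar>c * f x\<bar>) = (s / c < \<bar>f x\<bar>)" for x
      using \<open>0 < c\<close> by (simp add: abs_mult field_simps)
    then have "distribution_function X (\<lambda>x. c * f x) s = distribution_function X f (s / c)"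
      by (simp add: distribution_function_def)
    moreover have "(ennreal s < ennreal c * y) = (ennreal (s / c) < y)" for y
    proof (cases y)
      case (real r)
      then have "ennreal c * y = ennreal (c * r)"
        using \<open>0 < c\<close> by (simp add: ennreal_mult)
      then show ?thesis using real that \<open>0 < c\<close>
        by (simp add: ennreal_less_iff pos_divide_less_eq mult.commute)
    qed (use \<open>0 < c\<close> in \<open>auto simp: ennreal_mult_top\<close>)
    ultimately show ?thesis using that \<open>0 < c\<close>
      by (simp add: less_rearrangement_iff f)
  qed
  then show ?thesis by (intro antisym ennreal_le_via_less) auto
qed

lemma rearrangement_indicator:
  assumes "B \<in> sets X"
  shows "decreasing_rearrangement X (indicator B) t = (if ennreal t < emeasure X B then 1 else 0)"
proof -
  have "ennreal s < decreasing_rearrangement X (indicator B) t \<longleftrightarrow>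
        ennreal s < (if ennreal t < emeasure X B then 1 else 0)" if "0 \<le> s" for s
  proof -
    have "{x \<in> space X. s < \<bar>indicator B x\<bar>} = (if s < 1 then B else {})"
      using sets.sets_into_space[OF assms] that by (auto simp: indicator_def)
    moreover have "(ennreal s < 1) = (s < 1)" using ennreal_less_iff[OF that, of 1] by simp
    ultimately show ?thesis using that assms
      by (auto simp: less_rearrangement_iff distribution_function_def)
  qed
  then show ?thesis by (intro antisym ennreal_le_via_less) auto
qed

section \<open>Integrals of the rearrangement\<close>

text \<open>Writes a possibly infinite value as the length of the set of positive reals below it,
  which is the starting point of each layer cake argument.\<close>

lemma emeasure_lborel_initial_segment: "emeasure lborel {t. 0 < t \<and> ennreal t < x} = x"
proof (cases x)
  case (real r)
  then have "{t. 0 < t \<and> ennreal t < x} = {0<..<r}"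
    by (auto simp: ennreal_less_iff)
  then show ?thesis using real by simp
next
  case top
  have "top \<le> emeasure lborel {t::real. 0 < t}"
  proof (rule ennreal_le_via_less)
    fix s :: real assume "0 \<le> s"
    have "ennreal s < ennreal (s + 1)" using \<open>0 \<le> s\<close> by (intro ennreal_lessI) auto
    also have "\<dots> = emeasure lborel {0<..<s + 1}" using \<open>0 \<le> s\<close> by simp
    also have "\<dots> \<le> emeasure lborel {t::real. 0 < t}" by (intro emeasure_mono) auto
    finally show "ennreal s < emeasure lborel {t::real. 0 < t}" .
  qed
  then show ?thesis using top by (simp add: top_unique)
qed

text \<open>Tonelli's theorem for the region below the graph of \<open>F\<close>; this is where
  sigma-finiteness enters.\<close>

lemma nn_integral_layer_cake:
  assumes "sigma_finite_measure M" and [measurable]: "F \<in> borel_measurable M"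
  shows "(\<integral>\<^sup>+x. F x \<partial>M) = (\<integral>\<^sup>+s\<in>{0<..}. emeasure M {x \<in> space M. ennreal s < F x} \<partial>lborel)"
proof -
  interpret M: sigma_finite_measure M by fact
  interpret pair_sigma_finite lborel M ..
  define f where "f s x = (if 0 < s \<and> ennreal s < F x then 1 else 0 :: ennreal)" for s x
  have [measurable]: "(\<lambda>(s, x). f s x) \<in> borel_measurable (lborel \<Otimes>\<^sub>M M)"
    unfolding f_def by measurable
  have "(\<integral>\<^sup>+x. F x \<partial>M) = (\<integral>\<^sup>+x. \<integral>\<^sup>+s. f s x \<partial>lborel \<partial>M)"
  proof (rule nn_integral_cong)
    fix x
    have "f s x = indicator {t. 0 < t \<and> ennreal t < F x} s" for s
      by (simp add: f_def indicator_def)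
    then show "F x = (\<integral>\<^sup>+s. f s x \<partial>lborel)"
      by (simp add: emeasure_lborel_initial_segment)
  qed
  also have "\<dots> = (\<integral>\<^sup>+s. \<integral>\<^sup>+x. f s x \<partial>M \<partial>lborel)"
    by (rule Fubini') measurable
  also have "\<dots> = (\<integral>\<^sup>+s\<in>{0<..}. emeasure M {x \<in> space M. ennreal s < F x} \<partial>lborel)"
  proof (rule nn_integral_cong)
    fix s :: real
    have "(\<integral>\<^sup>+x. f s x \<partial>M) = (\<integral>\<^sup>+x. indicator {0<..} s * indicator {x \<in> space M. ennreal s < F x} x \<partial>M)"
      by (rule nn_integral_cong) (simp add: f_def indicator_def)
    then show "(\<integral>\<^sup>+x. f s x \<partial>M) = emeasure M {x \<in> space M. ennreal s < F x} * indicator {0<..} s"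
      by (simp add: nn_integral_cmult mult.commute)
  qed
  finally show ?thesis .
qed

text \<open>Both sides have the same layer cake: for \<open>s > 0\<close> the set of
  \<open>t > 0\<close> where the rearrangement exceeds \<open>s\<close> is an initial segment whose
  length is the distribution function at \<open>s\<close>.\<close>

lemma nn_integral_rearrangement:
  assumes "sigma_finite_measure X" and f [measurable]: "f \<in> borel_measurable X"
  shows "(\<integral>\<^sup>+t\<in>{0<..}. decreasing_rearrangement X f t \<partial>lborel) = (\<integral>\<^sup>+x. ennreal \<bar>f x\<bar> \<partial>X)"
proof -
  have "(\<integral>\<^sup>+t\<in>{0<..}. decreasing_rearrangement X f t \<partial>lborel) =
      (\<integral>\<^sup>+s\<in>{0<..}. emeasure lborel
        {t \<in> space lborel. ennreal s < decreasing_rearrangement X f t * indicator {0<..} t} \<partial>lborel)"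
    by (rule nn_integral_layer_cake) (auto intro: lborel.sigma_finite_measure_axioms)
  also have "\<dots> = (\<integral>\<^sup>+s\<in>{0<..}. emeasure X {x \<in> space X. ennreal s < ennreal \<bar>f x\<bar>} \<partial>lborel)"
  proof (rule nn_integral_cong)
    fix s :: real
    show "emeasure lborel {t \<in> space lborel. ennreal s < decreasing_rearrangement X f t * indicator {0<..} t}
        * indicator {0<..} s =
      emeasure X {x \<in> space X. ennreal s < ennreal \<bar>f x\<bar>} * indicator {0<..} s"
    proof (cases "0 < s")
      case True
      have "{t \<in> space lborel. ennreal s < decreasing_rearrangement X f t * indicator {0<..} t}
          = {t. 0 < t \<and> ennreal t < distribution_function X f s}"
        using True by (auto simp: indicator_def less_rearrangement_iff[OF f] split: if_splits)
      moreover have "{x \<in> space X. ennreal s < ennreal \<bar>f x\<bar>} = {x \<in> space X. s < \<bar>f x\<bar>}"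
        using True by (simp add: ennreal_less_iff)
      ultimately show ?thesis
        by (simp add: emeasure_lborel_initial_segment distribution_function_def)
    qed simp
  qed
  also have "\<dots> = (\<integral>\<^sup>+x. ennreal \<bar>f x\<bar> \<partial>X)"
    by (rule nn_integral_layer_cake[symmetric]) (auto intro: assms)
  finally show ?thesis .
qed

text \<open>Cutting off at height \<open>c\<close> shifts all levels by \<open>c\<close>.
  Subtraction in \<open>ennreal\<close> truncates at 0, which matches the
  \<open>max\<close>.\<close>

lemma rearrangement_truncation:
  assumes f [measurable]: "f \<in> borel_measurable X" and "0 \<le> c"
  shows "decreasing_rearrangement X (\<lambda>x. max 0 (\<bar>f x\<bar> - c)) t = decreasing_rearrangement X f t - ennreal c"
proof -
  have "ennreal s < decreasing_rearrangement X (\<lambda>x. max 0 (\<bar>f x\<bar> - c)) t \<longleftrightarrow>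
        ennreal s < decreasing_rearrangement X f t - ennreal c" if "0 \<le> s" for s
  proof -
    have "(s < \<bar>max 0 (\<bar>f x\<bar> - c)\<bar>) = (s + c < \<bar>f x\<bar>)" for x
      using that by auto
    then have "distribution_function X (\<lambda>x. max 0 (\<bar>f x\<bar> - c)) s = distribution_function X f (s + c)"
      by (simp add: distribution_function_def)
    moreover have "(ennreal s < y - ennreal c) = (ennreal (s + c) < y)" for y
    proof (cases y)
      case (real r)
      then have "y - ennreal c = ennreal (r - c)"
        using \<open>0 \<le> c\<close> by (simp add: ennreal_minus)
      then show ?thesis using real that \<open>0 \<le> c\<close>
        by (auto simp: ennreal_less_iff simp del: ennreal_plus)
    qed simp
    ultimately show ?thesis using that \<open>0 \<le> c\<close>
      by (simp add: less_rearrangement_iff f del: ennreal_plus)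
  qed
  then show ?thesis by (intro antisym ennreal_le_via_less) auto
qed

text \<open>
  As a function of \<open>c\<close>, \<open>\<integral> (\<bar>f\<bar> - c)\<^sub>+ + c u\<close> attains its minimum, the integral of \<open>f\<^sup>*\<close> over \<open>(0, u)\<close>,
  at \<open>c = f\<^sup>*(u)\<close>; subadditivity in \<open>f\<close> is read off this formula.
\<close>

lemma rearrangement_integral_le:
  assumes X: "sigma_finite_measure X" and f [measurable]: "f \<in> borel_measurable X"
    and "0 \<le> c" "0 \<le> u"
  shows "(\<integral>\<^sup>+t\<in>{0<..<u}. decreasing_rearrangement X f t \<partial>lborel)
    \<le> (\<integral>\<^sup>+x. ennreal (max 0 (\<bar>f x\<bar> - c)) \<partial>X) + ennreal c * ennreal u"
proof -
  let ?r = "decreasing_rearrangement X f"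
  have "(\<integral>\<^sup>+t\<in>{0<..<u}. ?r t \<partial>lborel)
      \<le> (\<integral>\<^sup>+t. (?r t - ennreal c) * indicator {0<..} t + ennreal c * indicator {0<..<u} t \<partial>lborel)"
  proof (rule nn_integral_mono)
    fix t
    have "?r t \<le> (?r t - ennreal c) + ennreal c" 
      by (cases "ennreal c \<le> ?r t") (simp_all add: diff_add_cancel_ennreal add_increasing)
    then show "?r t * indicator {0<..<u} t
      \<le> (?r t - ennreal c) * indicator {0<..} t + ennreal c * indicator {0<..<u} t"
      by (auto simp: indicator_def)
  qed
  also have "\<dots> = (\<integral>\<^sup>+t\<in>{0<..}. (?r t - ennreal c) \<partial>lborel) + ennreal c * ennreal u"
    using \<open>0 \<le> u\<close> by (subst nn_integral_add) (auto simp: nn_integral_cmult)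
  also have "(\<integral>\<^sup>+t\<in>{0<..}. (?r t - ennreal c) \<partial>lborel)
      = (\<integral>\<^sup>+x. ennreal \<bar>max 0 (\<bar>f x\<bar> - c)\<bar> \<partial>X)"
    by (subst nn_integral_rearrangement[OF X, symmetric])
      (simp_all add: rearrangement_truncation[OF f \<open>0 \<le> c\<close>])
  finally show ?thesis by simp
qed

text \<open>At the height \<open>c = f\<^sup>*(u)\<close> nothing is lost: to the left of
  \<open>u\<close> the rearrangement is at least \<open>c\<close>, so subtracting and adding
  \<open>c\<close> cancel, and to the right it is at most \<open>c\<close>, so the truncated
  difference vanishes.\<close>

lemma rearrangement_integral_eq:
  assumes X: "sigma_finite_measure X" and f [measurable]: "f \<in> borel_measurable X"
    and "0 \<le> c" "0 \<le> u" and c: "decreasing_rearrangement X f u = ennreal c"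
  shows "(\<integral>\<^sup>+t\<in>{0<..<u}. decreasing_rearrangement X f t \<partial>lborel)
    = (\<integral>\<^sup>+x. ennreal (max 0 (\<bar>f x\<bar> - c)) \<partial>X) + ennreal c * ennreal u"
proof -
  let ?r = "decreasing_rearrangement X f"
  have "(\<integral>\<^sup>+t\<in>{0<..<u}. ?r t \<partial>lborel)
      = (\<integral>\<^sup>+t. (?r t - ennreal c) * indicator {0<..} t + ennreal c * indicator {0<..<u} t \<partial>lborel)"
  proof (rule nn_integral_cong)
    fix t
    show "?r t * indicator {0<..<u} t
      = (?r t - ennreal c) * indicator {0<..} t + ennreal c * indicator {0<..<u} t"
    proof (cases "t < u")
      case True
      then have "ennreal c \<le> ?r t" using rearrangement_antimono[of t u X f] c by simp
      then have "?r t - ennreal c + ennreal c = ?r t" by (simp add: diff_add_cancel_ennreal)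
      then show ?thesis using True by (auto simp: indicator_def)
    next
      case False
      then have "?r t \<le> ennreal c" using rearrangement_antimono[of u t X f] c by simp
      then have "?r t - ennreal c = 0"
        using order_le_less_trans[of "?r t" "ennreal c" top] by (simp add: diff_eq_0_iff_ennreal)
      then show ?thesis using False by (auto simp: indicator_def)
    qed
  qed
  also have "\<dots> = (\<integral>\<^sup>+t\<in>{0<..}. (?r t - ennreal c) \<partial>lborel) + ennreal c * ennreal u"
    using \<open>0 \<le> u\<close> by (subst nn_integral_add) (auto simp: nn_integral_cmult)
  also have "(\<integral>\<^sup>+t\<in>{0<..}. (?r t - ennreal c) \<partial>lborel)
      = (\<integral>\<^sup>+x. ennreal \<bar>max 0 (\<bar>f x\<bar> - c)\<bar> \<partial>X)"
    by (subst nn_integral_rearrangement[OF X, symmetric])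
      (simp_all add: rearrangement_truncation[OF f \<open>0 \<le> c\<close>])
  finally show ?thesis by simp
qed

lemma rearrangement_le_integral:
  "ennreal u * decreasing_rearrangement X f u \<le> (\<integral>\<^sup>+t\<in>{0<..<u}. decreasing_rearrangement X f t \<partial>lborel)"
proof (cases "0 < u")
  case True
  have "ennreal u * decreasing_rearrangement X f u
      = (\<integral>\<^sup>+t. decreasing_rearrangement X f u * indicator {0<..<u} t \<partial>lborel)"
    using True by (simp add: nn_integral_cmult mult.commute)
  also have "\<dots> \<le> (\<integral>\<^sup>+t\<in>{0<..<u}. decreasing_rearrangement X f t \<partial>lborel)"
    by (intro nn_integral_mono) (auto simp: indicator_def intro: rearrangement_antimono)
  finally show ?thesis .
qed (simp add: ennreal_neg)

text \<open>If \<open>c\<close> and \<open>d\<close> are optimal heights for \<open>f\<close> and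
  \<open>g\<close>, then \<open>c + d\<close> is an admissible height for the sum, and the positive
  part of \<open>\<bar>f + g\<bar> - (c + d)\<close> is at most the sum of the two separate positive
  parts.\<close>

lemma rearrangement_integral_subadd:
  assumes X: "sigma_finite_measure X"
    and f [measurable]: "f \<in> borel_measurable X" and g [measurable]: "g \<in> borel_measurable X"
  shows "(\<integral>\<^sup>+t\<in>{0<..<u}. decreasing_rearrangement X (\<lambda>x. f x + g x) t \<partial>lborel)
    \<le> (\<integral>\<^sup>+t\<in>{0<..<u}. decreasing_rearrangement X f t \<partial>lborel)
      + (\<integral>\<^sup>+t\<in>{0<..<u}. decreasing_rearrangement X g t \<partial>lborel)" (is "_ \<le> ?F + ?G")
proof (cases "0 < u \<and> ?F < top \<and> ?G < top")
  case True
  \<comment> \<open>Finite integrals force finite rearrangements at \<open>u\<close>, so the optimal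
    heights are real numbers.\<close>
  then have "ennreal u * decreasing_rearrangement X f u < top" "ennreal u * decreasing_rearrangement X g u < top"
    using rearrangement_le_integral order_le_less_trans by blast+
  then have "decreasing_rearrangement X f u < top" "decreasing_rearrangement X g u < top"
    using True by (auto simp: ennreal_mult_less_top)
  then obtain c d where c: "0 \<le> c" "decreasing_rearrangement X f u = ennreal c"
    and d: "0 \<le> d" "decreasing_rearrangement X g u = ennreal d"
    by (metis ennreal_cases less_irrefl)
  have "(\<integral>\<^sup>+t\<in>{0<..<u}. decreasing_rearrangement X (\<lambda>x. f x + g x) t \<partial>lborel)
      \<le> (\<integral>\<^sup>+x. ennreal (max 0 (\<bar>f x + g x\<bar> - (c + d))) \<partial>X) + ennreal (c + d) * ennreal u"
    using True c d by (intro rearrangement_integral_le X) auto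
  also have "(\<integral>\<^sup>+x. ennreal (max 0 (\<bar>f x + g x\<bar> - (c + d))) \<partial>X)
      \<le> (\<integral>\<^sup>+x. ennreal (max 0 (\<bar>f x\<bar> - c)) + ennreal (max 0 (\<bar>g x\<bar> - d)) \<partial>X)"
    by (intro nn_integral_mono) (auto simp flip: ennreal_plus intro!: ennreal_leI)
  also have "\<dots> = (\<integral>\<^sup>+x. ennreal (max 0 (\<bar>f x\<bar> - c)) \<partial>X) + (\<integral>\<^sup>+x. ennreal (max 0 (\<bar>g x\<bar> - d)) \<partial>X)"
    by (rule nn_integral_add) measurable
  finally show ?thesis
    using True c d rearrangement_integral_eq[OF X f c(1) _ c(2)] rearrangement_integral_eq[OF X g d(1) _ d(2)]
    by (simp add: ennreal_plus distrib_left distrib_right ac_simps)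
next
  case False
  then show ?thesis by (auto simp: not_less top_unique)
qed

text \<open>The superlevel sets of the decreasing weight \<open>t powr (a - 1)\<close> are initial segments.\<close>

lemma weighted_rearrangement_integral_subadd:
  assumes X: "sigma_finite_measure X" and "a \<le> 1"
    and f [measurable]: "f \<in> borel_measurable X" and g [measurable]: "g \<in> borel_measurable X"
  shows "(\<integral>\<^sup>+t\<in>{0<..}. decreasing_rearrangement X (\<lambda>x. f x + g x) t * ennreal (t powr (a - 1)) \<partial>lborel)
    \<le> (\<integral>\<^sup>+t\<in>{0<..}. decreasing_rearrangement X f t * ennreal (t powr (a - 1)) \<partial>lborel)
      + (\<integral>\<^sup>+t\<in>{0<..}. decreasing_rearrangement X g t * ennreal (t powr (a - 1)) \<partial>lborel)"
proof -
  define D where "D s = {t::real. 0 < t \<and> s < t powr (a - 1)}" for s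
  have [measurable]: "Measurable.pred (lborel \<Otimes>\<^sub>M lborel) (\<lambda>(s, t). t \<in> D s)"
    unfolding D_def by measurable
  \<comment> \<open>The layer cake is applied to the weight instead of the rearrangement, followed
    by Tonelli; it remains to treat a single superlevel set \<open>D s\<close>.\<close>
  have mix: "(\<integral>\<^sup>+t\<in>{0<..}. decreasing_rearrangement X h t * ennreal (t powr (a - 1)) \<partial>lborel)
      = (\<integral>\<^sup>+s\<in>{0<..}. (\<integral>\<^sup>+t\<in>D s. decreasing_rearrangement X h t \<partial>lborel) \<partial>lborel)" for h
  proof -
    let ?r = "decreasing_rearrangement X h"
    have "(\<integral>\<^sup>+t\<in>{0<..}. ?r t * ennreal (t powr (a - 1)) \<partial>lborel)
        = (\<integral>\<^sup>+t. \<integral>\<^sup>+s. (?r t * indicator (D s) t * indicator {0<..} s) \<partial>lborel \<partial>lborel)"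
    proof (rule nn_integral_cong)
      fix t :: real
      have "?r t * indicator (D s) t * indicator {0<..} s
          = ?r t * indicator {0<..} t * indicator {s. 0 < s \<and> ennreal s < ennreal (t powr (a - 1))} s" for s
        by (auto simp: D_def indicator_def ennreal_less_iff)
      then have "(\<integral>\<^sup>+s. (?r t * indicator (D s) t * indicator {0<..} s) \<partial>lborel)
          = ?r t * indicator {0<..} t * emeasure lborel {s. 0 < s \<and> ennreal s < ennreal (t powr (a - 1))}"
        by (simp add: nn_integral_cmult)
      then show "?r t * ennreal (t powr (a - 1)) * indicator {0<..} t
          = (\<integral>\<^sup>+s. (?r t * indicator (D s) t * indicator {0<..} s) \<partial>lborel)"
        unfolding emeasure_lborel_initial_segment by (simp add: ac_simps)
    qed
    also have "\<dots> = (\<integral>\<^sup>+s. \<integral>\<^sup>+t. (?r t * indicator (D s) t * indicator {0<..} s) \<partial>lborel \<partial>lborel)"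
      by (rule lborel_pair.Fubini') measurable
    also have "\<dots> = (\<integral>\<^sup>+s\<in>{0<..}. (\<integral>\<^sup>+t\<in>D s. ?r t \<partial>lborel) \<partial>lborel)"
      by (intro nn_integral_cong nn_integral_multc) (simp add: D_def)
    finally show ?thesis .
  qed
  have sub: "(\<integral>\<^sup>+t\<in>D s. decreasing_rearrangement X (\<lambda>x. f x + g x) t \<partial>lborel)
      \<le> (\<integral>\<^sup>+t\<in>D s. decreasing_rearrangement X f t \<partial>lborel)
        + (\<integral>\<^sup>+t\<in>D s. decreasing_rearrangement X g t \<partial>lborel)" if "0 < s" for s
  proof (cases "a = 1")
    case True
    \<comment> \<open>A constant weight has no bounded superlevel segment: a nonempty
      \<open>D s\<close> is the whole half line, where the integral of the rearrangement is the
      integral of the modulus.\<close>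
    then have "D s = (if s < 1 then {0<..} else {})" by (auto simp: D_def)
    moreover have "(\<integral>\<^sup>+x. ennreal \<bar>f x + g x\<bar> \<partial>X) \<le> (\<integral>\<^sup>+x. ennreal \<bar>f x\<bar> + ennreal \<bar>g x\<bar> \<partial>X)"
      by (intro nn_integral_mono) (simp add: abs_triangle_ineq flip: ennreal_plus)
    moreover have "\<dots> = (\<integral>\<^sup>+x. ennreal \<bar>f x\<bar> \<partial>X) + (\<integral>\<^sup>+x. ennreal \<bar>g x\<bar> \<partial>X)"
      by (rule nn_integral_add) measurable
    ultimately show ?thesis
      by (simp add: nn_integral_rearrangement[OF X])
  next
    case False
    then have "a - 1 < 0" using \<open>a \<le> 1\<close> by simp
    have "s < t powr (a - 1) \<longleftrightarrow> t < s powr (1 / (a - 1))" if "0 < t" for t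
    proof
      assume "s < t powr (a - 1)"
      then have "(t powr (a - 1)) powr (1 / (a - 1)) < s powr (1 / (a - 1))"
        using \<open>0 < s\<close> \<open>a - 1 < 0\<close> by (intro powr_less_mono2_neg) auto
      then show "t < s powr (1 / (a - 1))" using that \<open>a - 1 < 0\<close> by (simp add: powr_powr)
    next
      assume "t < s powr (1 / (a - 1))"
      then have "(s powr (1 / (a - 1))) powr (a - 1) < t powr (a - 1)"
        using that \<open>a - 1 < 0\<close> by (intro powr_less_mono2_neg) auto
      then show "s < t powr (a - 1)" using \<open>0 < s\<close> \<open>a - 1 < 0\<close> by (simp add: powr_powr)
    qed
    then have "D s = {0<..<s powr (1 / (a - 1))}" by (auto simp: D_def)
    then show ?thesis by (simp add: rearrangement_integral_subadd X)
  qed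
  have "(\<integral>\<^sup>+s\<in>{0<..}. (\<integral>\<^sup>+t\<in>D s. decreasing_rearrangement X (\<lambda>x. f x + g x) t \<partial>lborel) \<partial>lborel)
      \<le> (\<integral>\<^sup>+s. (\<integral>\<^sup>+t\<in>D s. decreasing_rearrangement X f t \<partial>lborel) * indicator {0<..} s
          + (\<integral>\<^sup>+t\<in>D s. decreasing_rearrangement X g t \<partial>lborel) * indicator {0<..} s \<partial>lborel)"
    using sub by (intro nn_integral_mono) (auto simp: indicator_def)
  also have "\<dots> = (\<integral>\<^sup>+s\<in>{0<..}. (\<integral>\<^sup>+t\<in>D s. decreasing_rearrangement X f t \<partial>lborel) \<partial>lborel)
      + (\<integral>\<^sup>+s\<in>{0<..}. (\<integral>\<^sup>+t\<in>D s. decreasing_rearrangement X g t \<partial>lborel) \<partial>lborel)"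
    by (rule nn_integral_add) measurable
  finally show ?thesis by (simp only: mix)
qed

section \<open>Minkowski and Jensen inequalities\<close>

text \<open>Convexity of the power, applied to \<open>a + b = \<theta> * (a / \<theta>) + (1 -
  \<theta>) * (b / (1 - \<theta>))\<close>. For fixed \<open>\<theta>\<close> the bound is linear in
  the \<open>q\<close>-th powers, so it passes through integrals and other subadditive functionals;
  optimising over \<open>\<theta>\<close> afterwards recovers Minkowski's inequality without
  duality.\<close>

lemma powr_add_le_weighted:
  fixes a b q \<theta> :: real
  assumes "1 \<le> q" "0 < \<theta>" "\<theta> < 1" "0 \<le> a" "0 \<le> b"
  shows "(a + b) powr q \<le> \<theta> powr (1 - q) * a powr q + (1 - \<theta>) powr (1 - q) * b powr q"
proof -
  have ge1: "1 \<le> t powr (1 - q)" if "0 < t" "t < 1" for t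
    using that assms(1) powr_mono'[of "1 - q" 0 t] by simp
  \<comment> \<open>Convexity is used for positive arguments; if a summand vanishes it is enough
    that the weights are at least 1.\<close>
  consider "a = 0" | "b = 0" | "0 < a" "0 < b" using assms by linarith
  then show ?thesis
  proof cases
    case 1
    then show ?thesis using mult_right_mono[OF ge1[of "1 - \<theta>"], of "b powr q"] assms by simp
  next
    case 2
    then show ?thesis using mult_right_mono[OF ge1[of \<theta>], of "a powr q"] assms by simp
  next
    case 3
    have eq: "t * (c / t) powr q = t powr (1 - q) * c powr q" if "0 < t" "0 < c" for t c
      using that by (simp add: powr_divide powr_diff)
    have "((1 - (1 - \<theta>)) *\<^sub>R (a / \<theta>) + (1 - \<theta>) *\<^sub>R (b / (1 - \<theta>))) powr q
        \<le> (1 - (1 - \<theta>)) * (a / \<theta>) powr q + (1 - \<theta>) * (b / (1 - \<theta>)) powr q"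
      using 3 assms by (intro convex_onD[OF powr_convex]) auto
    then show ?thesis using 3 assms eq[of \<theta> a] eq[of "1 - \<theta>" b] by simp
  qed
qed

lemma ennreal_powr_add_le_weighted:
  assumes "1 \<le> q" "0 < \<theta>" "\<theta> < 1"
  shows "ennreal_powr (x + y) q
    \<le> ennreal (\<theta> powr (1 - q)) * ennreal_powr x q + ennreal ((1 - \<theta>) powr (1 - q)) * ennreal_powr y q"
proof (cases "x = top \<or> y = top")
  case True
  then show ?thesis using assms by (auto simp: ennreal_mult_top)
next
  case False
  then obtain a b where ab: "0 \<le> a" "x = ennreal a" "0 \<le> b" "y = ennreal b"
    by (metis ennreal_cases)
  then have "ennreal_powr (x + y) q = ennreal ((a + b) powr q)"
    by (simp flip: ennreal_plus)
  also have "\<dots> \<le> ennreal (\<theta> powr (1 - q) * a powr q + (1 - \<theta>) powr (1 - q) * b powr q)"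
    using powr_add_le_weighted[OF assms ab(1,3)] by (rule ennreal_leI)
  finally show ?thesis using ab by (simp add: ennreal_mult)
qed

text \<open>The choice \<open>\<theta> = x / (x + y)\<close>, perturbed to avoid \<open>\<theta> \<in> {0, 1}\<close>.\<close>

lemma minkowski_from_weighted:
  assumes "1 \<le> q"
    and le: "\<And>\<theta>. 0 < \<theta> \<Longrightarrow> \<theta> < 1 \<Longrightarrow>
      A \<le> ennreal (\<theta> powr (1 - q)) * ennreal_powr x q + ennreal ((1 - \<theta>) powr (1 - q)) * ennreal_powr y q"
  shows "ennreal_powr A (1 / q) \<le> x + y"
proof (cases "x = top \<or> y = top")
  case False
  then obtain a b where ab: "0 \<le> a" "x = ennreal a" "0 \<le> b" "y = ennreal b"
    by (metis ennreal_cases)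
  show ?thesis
  proof (rule ennreal_le_epsilon)
    fix e :: real assume "0 < e"
    define c d where "c = a + e / 2" and "d = b + e / 2"
    have pos: "0 < c" "0 < d" "a \<le> c" "b \<le> d" using ab \<open>0 < e\<close> by (auto simp: c_def d_def)
    define \<theta> where "\<theta> = c / (c + d)"
    have \<theta>: "0 < \<theta>" "\<theta> < 1" "1 - \<theta> = d / (c + d)" using pos by (auto simp: \<theta>_def field_simps)
    have eq: "(t / (c + d)) powr (1 - q) * t powr q = t * (c + d) powr (q - 1)" if "0 < t" for t
    proof -
      have "(t / (c + d)) powr (1 - q) = t powr (1 - q) * (c + d) powr (q - 1)"
        using that pos by (simp add: powr_divide powr_minus_divide[of "c + d" "1 - q", simplified])
      then show ?thesis using that by (simp flip: powr_add)
    qed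
    have "A \<le> ennreal (\<theta> powr (1 - q) * a powr q + (1 - \<theta>) powr (1 - q) * b powr q)"
      using le[OF \<theta>(1,2)] ab by (simp add: ennreal_mult)
    also have "\<dots> \<le> ennreal (\<theta> powr (1 - q) * c powr q + (1 - \<theta>) powr (1 - q) * d powr q)"
      using ab pos assms(1) by (intro ennreal_leI add_mono mult_left_mono powr_mono2) auto
    also have "\<theta> powr (1 - q) * c powr q + (1 - \<theta>) powr (1 - q) * d powr q = (c + d) * (c + d) powr (q - 1)"
      unfolding \<theta>(3) unfolding \<theta>_def using pos by (simp add: eq distrib_right)
    also have "\<dots> = (c + d) powr q" using pos by (simp add: powr_mult_base)
    finally have "ennreal_powr A (1 / q) \<le> ennreal_powr (ennreal ((c + d) powr q)) (1 / q)"
      using assms(1) by (intro ennreal_powr_mono) auto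
    also have "\<dots> = ennreal (c + d)"
      using pos assms(1) by (simp add: powr_powr del: ennreal_plus)
    also have "c + d = a + b + e" by (simp add: c_def d_def)
    finally show "ennreal_powr A (1 / q) \<le> x + y + ennreal e"
      using ab \<open>0 < e\<close> by simp
  qed
qed auto

lemma ennreal_powr_root [simp]: "0 < q \<Longrightarrow> ennreal_powr (ennreal_powr x (1 / q)) q = x"
  by (simp add: ennreal_powr_powr)

text \<open>The weight \<open>W\<close> stays in the integrand, so that the Lorentz weight on the
  half line is covered without passing to a density measure.\<close>

lemma nn_integral_minkowski:
  assumes "1 \<le> q"
    and [measurable]: "F \<in> borel_measurable M" "G \<in> borel_measurable M" "W \<in> borel_measurable M"
  shows "ennreal_powr (\<integral>\<^sup>+x. ennreal_powr (F x + G x) q * W x \<partial>M) (1 / q)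
    \<le> ennreal_powr (\<integral>\<^sup>+x. ennreal_powr (F x) q * W x \<partial>M) (1 / q)
      + ennreal_powr (\<integral>\<^sup>+x. ennreal_powr (G x) q * W x \<partial>M) (1 / q)"
proof (rule minkowski_from_weighted[OF assms(1)])
  fix \<theta> :: real assume \<theta>: "0 < \<theta>" "\<theta> < 1"
  have "(\<integral>\<^sup>+x. ennreal_powr (F x + G x) q * W x \<partial>M)
      \<le> (\<integral>\<^sup>+x. ennreal (\<theta> powr (1 - q)) * (ennreal_powr (F x) q * W x)
          + ennreal ((1 - \<theta>) powr (1 - q)) * (ennreal_powr (G x) q * W x) \<partial>M)"
    unfolding mult.assoc[symmetric] distrib_right[symmetric]
    by (intro nn_integral_mono mult_right_mono ennreal_powr_add_le_weighted assms(1) \<theta>) simp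
  also have "\<dots> = ennreal (\<theta> powr (1 - q)) * (\<integral>\<^sup>+x. ennreal_powr (F x) q * W x \<partial>M)
      + ennreal ((1 - \<theta>) powr (1 - q)) * (\<integral>\<^sup>+x. ennreal_powr (G x) q * W x \<partial>M)"
    by (simp add: nn_integral_add nn_integral_cmult)
  finally show "(\<integral>\<^sup>+x. ennreal_powr (F x + G x) q * W x \<partial>M)
    \<le> ennreal (\<theta> powr (1 - q)) * ennreal_powr (ennreal_powr (\<integral>\<^sup>+x. ennreal_powr (F x) q * W x \<partial>M) (1 / q)) q
      + ennreal ((1 - \<theta>) powr (1 - q)) * ennreal_powr (ennreal_powr (\<integral>\<^sup>+x. ennreal_powr (G x) q * W x \<partial>M) (1 / q)) q"
    using assms(1) by simp
qed

text \<open>Jensen's inequality for the density \<open>k\<close> of mass at most \<open>c\<close>. A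
  tangent to the \<open>q\<close>-th power at a free point \<open>y\<close>, in the form of Young's
  inequality, is integrated against \<open>k\<close>, and \<open>y\<close> is chosen at the
  end.\<close>

lemma nn_integral_jensen_powr:
  assumes "1 \<le> q" "0 < c"
    and [measurable]: "g \<in> borel_measurable M" "k \<in> borel_measurable M"
    and k: "(\<integral>\<^sup>+x. k x \<partial>M) \<le> ennreal c"
  shows "ennreal_powr (\<integral>\<^sup>+x. g x * k x \<partial>M) q \<le> ennreal (c powr (q - 1)) * (\<integral>\<^sup>+x. ennreal_powr (g x) q * k x \<partial>M)"
proof (cases "\<integral>\<^sup>+x. ennreal_powr (g x) q * k x \<partial>M")
  case (real \<alpha>)
  have le: "(\<integral>\<^sup>+x. g x * k x \<partial>M) \<le> ennreal (c * y)" if "0 < y" "\<alpha> / c \<le> y powr q" for y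
  proof -
    have young: "x \<le> ennreal (y powr (1 - q) / q) * ennreal_powr x q + ennreal ((1 - 1 / q) * y)" for x
    proof (cases x)
      case (real r)
      have "r \<le> y powr (1 - q) / q * r powr q + (1 - 1 / q) * y"
      proof (cases "r = 0")
        case False
        then have "0 < r" using real by simp
        have "(r powr q * y powr (1 - q)) powr (1 / q) * y powr (1 - 1 / q)
            \<le> 1 / q * (r powr q * y powr (1 - q)) + (1 - 1 / q) * y"
          using \<open>0 < r\<close> \<open>0 < y\<close> assms(1) by (intro Youngs_inequality_0) auto
        moreover have "(r powr q * y powr (1 - q)) powr (1 / q) * y powr (1 - 1 / q) = r"
        proof -
          have "(1 - q) / q + (1 - 1 / q) = 0" using assms(1) by (simp add: field_simps)
          then have "y powr ((1 - q) / q) * y powr (1 - 1 / q) = 1"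
            using \<open>0 < y\<close> by (simp flip: powr_add)
          then show ?thesis using \<open>0 < r\<close> \<open>0 < y\<close> assms(1) by (simp add: powr_mult powr_powr)
        qed
        ultimately show ?thesis by (simp add: mult.commute)
      qed (use that assms in simp)
      then show ?thesis using real that assms(1)
        by (simp add: ennreal_mult[symmetric] ennreal_plus[symmetric] ennreal_leI del: ennreal_plus)
    qed (use that assms in \<open>simp add: ennreal_mult_top\<close>)
    have "(\<integral>\<^sup>+x. g x * k x \<partial>M) \<le> (\<integral>\<^sup>+x. (ennreal (y powr (1 - q) / q) * ennreal_powr (g x) q + ennreal ((1 - 1 / q) * y)) * k x \<partial>M)"
      by (intro nn_integral_mono mult_right_mono young) simp
    also have "\<dots> = (\<integral>\<^sup>+x. ennreal (y powr (1 - q) / q) * (ennreal_powr (g x) q * k x) + ennreal ((1 - 1 / q) * y) * k x \<partial>M)"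
      by (simp add: distrib_right mult.assoc)
    also have "\<dots> = ennreal (y powr (1 - q) / q) * ennreal \<alpha> + ennreal ((1 - 1 / q) * y) * (\<integral>\<^sup>+x. k x \<partial>M)"
      by (simp add: nn_integral_add nn_integral_cmult real)
    also have "\<dots> \<le> ennreal (y powr (1 - q) / q) * ennreal (c * y powr q) + ennreal ((1 - 1 / q) * y) * ennreal c"
      using that k \<open>0 < c\<close> by (intro add_mono mult_left_mono ennreal_leI) (auto simp: field_simps)
    also have "\<dots> = ennreal (y powr (1 - q) / q * (c * y powr q) + (1 - 1 / q) * y * c)"
      using that assms(1,2)
      by (simp add: ennreal_mult[symmetric] ennreal_plus[symmetric] del: ennreal_plus)
    also have "y powr (1 - q) / q * (c * y powr q) + (1 - 1 / q) * y * c = c * y"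
    proof -
      have "y powr (1 - q) * y powr q = y" using \<open>0 < y\<close> by (simp flip: powr_add)
      then have "y powr (1 - q) / q * (c * y powr q) = c * y / q" by (simp add: field_simps)
      then show ?thesis by (simp add: field_simps)
    qed
    finally show ?thesis .
  qed
  have \<alpha>: "0 \<le> \<alpha>" by fact
  have "(\<integral>\<^sup>+x. g x * k x \<partial>M) \<le> ennreal (c * (\<alpha> / c) powr (1 / q))"
  proof (rule ennreal_le_epsilon)
    fix e :: real assume "0 < e"
    \<comment> \<open>The optimal point is the \<open>q\<close>-mean
      \<open>(\<alpha> / c) powr (1 / q)\<close>. Adding \<open>e / c\<close> keeps \<open>y\<close>
      positive when \<open>\<alpha> = 0\<close> and costs exactly \<open>e\<close> in
      \<open>c * y\<close>.\<close>
    define y where "y = (\<alpha> / c) powr (1 / q) + e / c"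
    have "0 < y" using \<open>0 < e\<close> \<open>0 < c\<close> by (auto simp: y_def intro: add_nonneg_pos)
    have "\<alpha> / c = ((\<alpha> / c) powr (1 / q)) powr q" using \<alpha> \<open>0 < c\<close> assms(1) by (simp add: powr_powr)
    also have "\<dots> \<le> y powr q"
      using \<open>0 < e\<close> \<open>0 < c\<close> assms(1) by (intro powr_mono2) (auto simp: y_def)
    finally have "(\<integral>\<^sup>+x. g x * k x \<partial>M) \<le> ennreal (c * y)" using \<open>0 < y\<close> by (intro le)
    also have "c * y = c * (\<alpha> / c) powr (1 / q) + e" using \<open>0 < c\<close> by (simp add: y_def field_simps)
    finally show "(\<integral>\<^sup>+x. g x * k x \<partial>M) \<le> ennreal (c * (\<alpha> / c) powr (1 / q)) + ennreal e"
      using \<open>0 < c\<close> \<open>0 < e\<close> by simp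
  qed
  then have "ennreal_powr (\<integral>\<^sup>+x. g x * k x \<partial>M) q \<le> ennreal_powr (ennreal (c * (\<alpha> / c) powr (1 / q))) q"
    using assms(1) by (intro ennreal_powr_mono) auto
  also have "\<dots> = ennreal (c powr q * (\<alpha> / c))"
    using \<alpha> assms(1,2) by (simp add: powr_mult powr_powr)
  also have "c powr q * (\<alpha> / c) = c powr (q - 1) * \<alpha>" using \<open>0 < c\<close> by (simp add: powr_diff)
  finally show ?thesis using real by (simp add: ennreal_mult)
qed (use assms in \<open>simp add: ennreal_mult_top\<close>)

section \<open>The Lorentz functional and Hardy's inequality\<close>

text \<open>The Lorentz norm with an arbitrary profile in place of the rearrangement, so that it can
  also be evaluated at the averaged rearrangement.\<close>

definition lorentz_functional :: "real \<Rightarrow> ennreal \<Rightarrow> (real \<Rightarrow> ennreal) \<Rightarrow> ennreal" where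
  "lorentz_functional p q \<phi> =
     (if q = top
      then SUP t\<in>{0<..}. ennreal (t powr (1 / p)) * \<phi> t
      else ennreal_powr
        (\<integral>\<^sup>+t\<in>{0<..}. (ennreal_powr (ennreal (t powr (1 / p)) * \<phi> t) (enn2real q) / ennreal t) \<partial>lborel)
        (1 / enn2real q))"

lemma lorentz_norm_eq_functional:
  "lorentz_norm X p q f = lorentz_functional p q (decreasing_rearrangement X f)"
  by (simp add: lorentz_norm_def lorentz_functional_def)

lemma lorentz_functional_top:
  "lorentz_functional p top \<phi> = (SUP t\<in>{0<..}. ennreal (t powr (1 / p)) * \<phi> t)"
  by (simp add: lorentz_functional_def)

text \<open>The factor \<open>t powr (1 / p)\<close> and the measure \<open>dt / t\<close> merge
  into one weight. The functional becomes a weighted \<open>L\<^sup>q\<close> norm, to which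
  Minkowski and monotone convergence apply.\<close>

lemma lorentz_functional_finite:
  assumes "0 < q"
  shows "lorentz_functional p (ennreal q) \<phi> =
    ennreal_powr (\<integral>\<^sup>+t. ennreal_powr (\<phi> t) q * (ennreal (t powr (q / p - 1)) * indicator {0<..} t) \<partial>lborel) (1 / q)"
proof -
  have "ennreal_powr (ennreal (t powr (1 / p)) * \<phi> t) q / ennreal t
      = ennreal_powr (\<phi> t) q * ennreal (t powr (q / p - 1))" if "0 < t" for t
  proof -
    have "ennreal_powr (ennreal (t powr (1 / p)) * \<phi> t) q = ennreal (t powr (q / p)) * ennreal_powr (\<phi> t) q"
      using assms by (simp add: ennreal_powr_mult powr_powr)
    moreover have "ennreal (t powr (q / p - 1)) = ennreal (t powr (q / p)) * inverse (ennreal t)"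
      using that by (simp add: inverse_ennreal ennreal_mult[symmetric] powr_diff divide_inverse)
    ultimately show ?thesis by (simp add: divide_ennreal_def ac_simps)
  qed
  then have "(\<integral>\<^sup>+t\<in>{0<..}. (ennreal_powr (ennreal (t powr (1 / p)) * \<phi> t) q / ennreal t) \<partial>lborel)
      = (\<integral>\<^sup>+t. ennreal_powr (\<phi> t) q * (ennreal (t powr (q / p - 1)) * indicator {0<..} t) \<partial>lborel)"
    by (intro nn_integral_cong) (simp add: indicator_def)
  then show ?thesis using assms by (simp add: lorentz_functional_def)
qed

lemma lorentz_functional_mono:
  assumes "\<And>t. 0 < t \<Longrightarrow> \<phi> t \<le> \<psi> t"
  shows "lorentz_functional p q \<phi> \<le> lorentz_functional p q \<psi>"
  unfolding lorentz_functional_def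
  using assms
  by (auto intro!: SUP_subset_mono mult_left_mono ennreal_powr_mono nn_integral_mono divide_right_mono_ennreal
      simp: indicator_def)

lemma lorentz_functional_zero: "lorentz_functional p q (\<lambda>t. 0) = 0"
  by (simp add: lorentz_functional_def)

lemma lorentz_functional_cmult:
  assumes "0 < q" and [measurable]: "\<phi> \<in> borel_measurable borel"
  shows "lorentz_functional p q (\<lambda>t. c * \<phi> t) = c * lorentz_functional p q \<phi>"
proof (cases q)
  case top
  then show ?thesis by (simp add: lorentz_functional_top SUP_mult_left_ennreal mult.left_commute)
next
  case (real r)
  then have "0 < r" using assms(1) by (auto simp: less_le)
  have "(\<integral>\<^sup>+t. ennreal_powr (c * \<phi> t) r * (ennreal (t powr (r / p - 1)) * indicator {0<..} t) \<partial>lborel)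
     = ennreal_powr c r * (\<integral>\<^sup>+t. ennreal_powr (\<phi> t) r * (ennreal (t powr (r / p - 1)) * indicator {0<..} t) \<partial>lborel)"
    using \<open>0 < r\<close> by (subst nn_integral_cmult[symmetric]) (auto simp: ennreal_powr_mult mult.assoc)
  then show ?thesis using \<open>0 < r\<close> real
    by (simp add: lorentz_functional_finite ennreal_powr_mult ennreal_powr_powr)
qed

lemma lorentz_functional_triangle:
  assumes "1 \<le> q" and [measurable]: "\<phi> \<in> borel_measurable borel" "\<psi> \<in> borel_measurable borel"
  shows "lorentz_functional p q (\<lambda>t. \<phi> t + \<psi> t) \<le> lorentz_functional p q \<phi> + lorentz_functional p q \<psi>"
proof (cases q)
  case (real r)
  then have "1 \<le> r" using assms(1) by simp
  then show ?thesis using real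
    by (simp add: lorentz_functional_finite nn_integral_minkowski)
next
  case top
  then show ?thesis
    by (auto simp: lorentz_functional_top distrib_left intro!: SUP_least add_mono SUP_upper)
qed

lemma lorentz_functional_SUP:
  assumes "0 < q" and [measurable]: "\<And>n. \<phi> n \<in> borel_measurable borel"
    and "\<And>n t. \<phi> n t \<le> \<phi> (Suc n) t"
  shows "lorentz_functional p q (\<lambda>t. SUP n. \<phi> n t) = (SUP n. lorentz_functional p q (\<phi> n))"
proof (cases q)
  case top
  then show ?thesis
    by (simp add: lorentz_functional_top SUP_mult_left_ennreal) (rule SUP_commute)
next
  case (real r)
  then have "0 < r" using assms(1) by (auto simp: less_le)
  have "(\<integral>\<^sup>+t. ennreal_powr (SUP n. \<phi> n t) r * (ennreal (t powr (r / p - 1)) * indicator {0<..} t) \<partial>lborel)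
     = (\<integral>\<^sup>+t. (SUP n. ennreal_powr (\<phi> n t) r * (ennreal (t powr (r / p - 1)) * indicator {0<..} t)) \<partial>lborel)"
    using \<open>0 < r\<close> by (simp add: ennreal_powr_SUP SUP_mult_right_ennreal)
  also have "\<dots> = (SUP n. \<integral>\<^sup>+t. ennreal_powr (\<phi> n t) r * (ennreal (t powr (r / p - 1)) * indicator {0<..} t) \<partial>lborel)"
    using \<open>0 < r\<close> assms(3)
    by (intro nn_integral_monotone_convergence_SUP incseq_SucI)
      (auto simp: le_fun_def intro!: mult_right_mono ennreal_powr_mono)
  finally show ?thesis using \<open>0 < r\<close> real
    by (simp add: lorentz_functional_finite ennreal_powr_SUP)
qed

text \<open>Dividing both exponents by \<open>a\<close> leaves \<open>q / p\<close>, and with it the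
  weight, unchanged.\<close>

lemma lorentz_functional_powr:
  assumes "0 < q" "0 < a"
  shows "lorentz_functional (p / a) (q / ennreal a) (\<lambda>t. ennreal_powr (\<phi> t) a)
    = ennreal_powr (lorentz_functional p q \<phi>) a"
proof (cases q)
  case top
  then show ?thesis using assms(2)
    by (simp add: lorentz_functional_top ennreal_powr_SUP ennreal_powr_mult powr_powr ennreal_top_divide)
next
  case (real r)
  then have "0 < r" using assms(1) by (auto simp: less_le)
  then have "q / ennreal a = ennreal (r / a)" using real assms(2) by (simp add: divide_ennreal)
  then show ?thesis using assms(2) \<open>0 < r\<close> real
    by (simp add: lorentz_functional_finite ennreal_powr_powr)
qed

text \<open>The origin of Hardy's constant; \<open>1 < p\<close> makes the singularity at 0
  integrable.\<close>

lemma nn_integral_powr_unit_interval: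
  assumes "1 < p"
  shows "(\<integral>\<^sup>+s\<in>{0<..<1}. ennreal (s powr (- 1 / p)) \<partial>lborel) \<le> ennreal (p / (p - 1))"
proof -
  have "((\<lambda>s. s powr (- 1 / p)) has_integral (1 powr (- 1 / p + 1) / (- 1 / p + 1))) {0..1::real}"
    using assms by (intro has_integral_powr_from_0) (auto simp: field_simps)
  moreover have "1 powr (- 1 / p + 1) / (- 1 / p + 1) = p / (p - 1)"
    using assms by (simp add: field_simps)
  ultimately have "((\<lambda>s. if s \<in> {0..1} then s powr (- 1 / p) else 0) has_integral (p / (p - 1))) UNIV"
    by (subst has_integral_restrict_UNIV) simp
  then have "(\<integral>\<^sup>+s. ennreal (if s \<in> {0..1} then s powr (- 1 / p) else 0) \<partial>lborel) = ennreal (p / (p - 1))"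
    by (intro nn_integral_has_integral_lborel) auto
  moreover have "(\<integral>\<^sup>+s\<in>{0<..<1}. ennreal (s powr (- 1 / p)) \<partial>lborel)
      \<le> (\<integral>\<^sup>+s. ennreal (if s \<in> {0..1} then s powr (- 1 / p) else 0) \<partial>lborel)"
    by (intro nn_integral_mono) (auto simp: indicator_def)
  ultimately show ?thesis by simp
qed

text \<open>The average is an integral over \<open>s\<close> in the unit interval of the dilates
  \<open>\<phi> (t * s)\<close>. Dilation by \<open>s\<close> costs the factor
  \<open>s powr (- 1 / p)\<close>, and these factors integrate to the constant.\<close>

lemma hardy_inequality_top:
  assumes "1 < p" and [measurable]: "\<phi> \<in> borel_measurable borel"
  shows "lorentz_functional p top (\<lambda>t. \<integral>\<^sup>+s\<in>{0<..<1}. \<phi> (t * s) \<partial>lborel)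
    \<le> ennreal (p / (p - 1)) * lorentz_functional p top \<phi>"
  unfolding lorentz_functional_top
proof (rule SUP_least)
  fix t :: real assume "t \<in> {0<..}"
  then have "0 < t" by simp
  define N where "N = (SUP t\<in>{0<..}. ennreal (t powr (1 / p)) * \<phi> t)"
  have bound: "ennreal (t powr (1 / p)) * \<phi> (t * s) \<le> N * ennreal (s powr (- 1 / p))" if "0 < s" for s
  proof -
    have "ennreal (t powr (1 / p)) = ennreal ((t * s) powr (1 / p)) * ennreal (s powr (- 1 / p))"
      using \<open>0 < t\<close> that by (simp add: powr_mult powr_minus flip: ennreal_mult)
    then have "ennreal (t powr (1 / p)) * \<phi> (t * s)
        = (ennreal ((t * s) powr (1 / p)) * \<phi> (t * s)) * ennreal (s powr (- 1 / p))"
      by (simp only: mult_ac)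
    also have "\<dots> \<le> N * ennreal (s powr (- 1 / p))"
      unfolding N_def using \<open>0 < t\<close> that by (intro mult_right_mono SUP_upper) auto
    finally show ?thesis .
  qed
  have "ennreal (t powr (1 / p)) * (\<integral>\<^sup>+s\<in>{0<..<1}. \<phi> (t * s) \<partial>lborel)
      = (\<integral>\<^sup>+s. ennreal (t powr (1 / p)) * \<phi> (t * s) * indicator {0<..<1} s \<partial>lborel)"
    by (subst nn_integral_cmult[symmetric]) (auto simp: mult.assoc)
  also have "\<dots> \<le> (\<integral>\<^sup>+s. N * (ennreal (s powr (- 1 / p)) * indicator {0<..<1} s) \<partial>lborel)"
    using bound by (intro nn_integral_mono) (auto simp: indicator_def)
  also have "\<dots> = N * (\<integral>\<^sup>+s\<in>{0<..<1}. ennreal (s powr (- 1 / p)) \<partial>lborel)"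
    by (rule nn_integral_cmult) measurable
  also have "\<dots> \<le> N * ennreal (p / (p - 1))"
    by (intro mult_left_mono nn_integral_powr_unit_interval assms(1)) simp
  finally show "ennreal (t powr (1 / p)) * (\<integral>\<^sup>+s\<in>{0<..<1}. \<phi> (t * s) \<partial>lborel)
      \<le> ennreal (p / (p - 1)) * (SUP t\<in>{0<..}. ennreal (t powr (1 / p)) * \<phi> t)"
    by (simp add: N_def mult.commute)
qed

text \<open>Jensen's inequality for the weight \<open>s powr (- 1 / p)\<close> on the unit interval, then scaling.\<close>

lemma hardy_inequality_finite:
  assumes "1 < p" "1 \<le> q" and [measurable]: "\<phi> \<in> borel_measurable borel"
  shows "lorentz_functional p (ennreal q) (\<lambda>t. \<integral>\<^sup>+s\<in>{0<..<1}. \<phi> (t * s) \<partial>lborel)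
    \<le> ennreal (p / (p - 1)) * lorentz_functional p (ennreal q) \<phi>"
proof -
  define c where "c = p / (p - 1)"
  have "0 < c" using assms by (simp add: c_def)
  define k where "k s = ennreal (s powr (- 1 / p)) * indicator {0<..<1} s" for s :: real
  define W where "W t = ennreal (t powr (q / p - 1)) * indicator {0<..} t" for t :: real
  have [measurable]: "k \<in> borel_measurable borel" "W \<in> borel_measurable borel"
    unfolding k_def W_def by measurable
  define I where "I = (\<integral>\<^sup>+t. ennreal_powr (\<phi> t) q * W t \<partial>lborel)"
  have k: "(\<integral>\<^sup>+s. k s \<partial>lborel) \<le> ennreal c"
    unfolding k_def c_def using assms(1) by (rule nn_integral_powr_unit_interval)
  have jensen: "ennreal_powr (\<integral>\<^sup>+s\<in>{0<..<1}. \<phi> (t * s) \<partial>lborel) q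
    \<le> ennreal (c powr (q - 1)) * (\<integral>\<^sup>+s. ennreal_powr (\<phi> (t * s)) q * (ennreal (s powr (q / p)) * k s) \<partial>lborel)" for t
  proof -
    \<comment> \<open>Inserting \<open>s powr (1 / p) * s powr (- 1 / p) = 1\<close> makes
      \<open>k\<close> the density for Jensen, of mass at most \<open>c\<close>. The extra
      \<open>s powr (q / p)\<close> is exactly what the dilation in \<open>t\<close>
      absorbs.\<close>
    have "(\<integral>\<^sup>+s\<in>{0<..<1}. \<phi> (t * s) \<partial>lborel) = (\<integral>\<^sup>+s. (\<phi> (t * s) * ennreal (s powr (1 / p))) * k s \<partial>lborel)"
    proof (rule nn_integral_cong)
      fix s :: real
      have "ennreal (s powr (1 / p)) * ennreal (s powr (- 1 / p)) = 1" if "0 < s"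
        using that by (simp add: ennreal_mult[symmetric] powr_add[symmetric])
      then show "\<phi> (t * s) * indicator {0<..<1} s = (\<phi> (t * s) * ennreal (s powr (1 / p))) * k s"
        by (simp add: k_def indicator_def mult.assoc)
    qed
    also have "ennreal_powr \<dots> q
      \<le> ennreal (c powr (q - 1)) * (\<integral>\<^sup>+s. ennreal_powr (\<phi> (t * s) * ennreal (s powr (1 / p))) q * k s \<partial>lborel)"
      by (rule nn_integral_jensen_powr[OF assms(2) \<open>0 < c\<close> _ _ k]) measurable
    also have "(\<integral>\<^sup>+s. ennreal_powr (\<phi> (t * s) * ennreal (s powr (1 / p))) q * k s \<partial>lborel)
      = (\<integral>\<^sup>+s. ennreal_powr (\<phi> (t * s)) q * (ennreal (s powr (q / p)) * k s) \<partial>lborel)"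
      using assms(2) by (intro nn_integral_cong) (simp add: ennreal_powr_mult powr_powr mult.assoc)
    finally show ?thesis .
  qed
  \<comment> \<open>Homogeneity of the weight: replacing \<open>t\<close> by \<open>s * t\<close>
    multiplies \<open>W\<close> by \<open>s powr (q / p - 1)\<close>, and the Jacobian supplies one
    more factor \<open>s\<close>.\<close>
  have scale: "ennreal (s powr (q / p)) * (\<integral>\<^sup>+t. ennreal_powr (\<phi> (t * s)) q * W t \<partial>lborel) = I" if "0 < s" for s
  proof -
    have "I = ennreal \<bar>s\<bar> * (\<integral>\<^sup>+t. ennreal_powr (\<phi> (0 + s * t)) q * W (0 + s * t) \<partial>lborel)"
      unfolding I_def using that by (intro nn_integral_real_affine) auto
    also have "\<dots> = (\<integral>\<^sup>+t. ennreal s * (ennreal_powr (\<phi> (0 + s * t)) q * W (0 + s * t)) \<partial>lborel)"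
      using that by (subst nn_integral_cmult) auto
    also have "\<dots> = (\<integral>\<^sup>+t. ennreal (s powr (q / p)) * (ennreal_powr (\<phi> (t * s)) q * W t) \<partial>lborel)"
    proof (rule nn_integral_cong)
      fix t :: real
      have "ennreal s * W (s * t) = ennreal (s powr (q / p)) * W t"
      proof (cases "0 < t")
        case True
        have "s * s powr (q / p - 1) = s powr (q / p)" using that by (simp add: powr_diff)
        then show ?thesis using that True
          by (simp add: W_def indicator_def powr_mult ennreal_mult[symmetric] mult.assoc[symmetric])
      qed (use that in \<open>simp add: W_def indicator_def zero_less_mult_iff\<close>)
      then show "ennreal s * (ennreal_powr (\<phi> (0 + s * t)) q * W (0 + s * t))
        = ennreal (s powr (q / p)) * (ennreal_powr (\<phi> (t * s)) q * W t)"
        by (simp add: mult.commute[of t s] mult.left_commute[of "ennreal s"]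
            mult.left_commute[of "ennreal (s powr (q / p))"])
    qed
    also have "\<dots> = ennreal (s powr (q / p)) * (\<integral>\<^sup>+t. ennreal_powr (\<phi> (t * s)) q * W t \<partial>lborel)"
      by (rule nn_integral_cmult) measurable
    finally show ?thesis ..
  qed
  have "(\<integral>\<^sup>+t. ennreal_powr (\<integral>\<^sup>+s\<in>{0<..<1}. \<phi> (t * s) \<partial>lborel) q * W t \<partial>lborel)
    \<le> (\<integral>\<^sup>+t. ennreal (c powr (q - 1)) *
        (\<integral>\<^sup>+s. ennreal_powr (\<phi> (t * s)) q * (ennreal (s powr (q / p)) * k s) * W t \<partial>lborel) \<partial>lborel)"
    by (intro nn_integral_mono) (simp add: nn_integral_multc mult.assoc[symmetric] mult_right_mono jensen[unfolded mult.assoc[symmetric]])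
  also have "\<dots> = ennreal (c powr (q - 1)) *
      (\<integral>\<^sup>+t. \<integral>\<^sup>+s. ennreal_powr (\<phi> (t * s)) q * (ennreal (s powr (q / p)) * k s) * W t \<partial>lborel \<partial>lborel)"
    by (rule nn_integral_cmult) measurable
  also have "(\<integral>\<^sup>+t. \<integral>\<^sup>+s. ennreal_powr (\<phi> (t * s)) q * (ennreal (s powr (q / p)) * k s) * W t \<partial>lborel \<partial>lborel)
      = (\<integral>\<^sup>+s. \<integral>\<^sup>+t. ennreal_powr (\<phi> (t * s)) q * (ennreal (s powr (q / p)) * k s) * W t \<partial>lborel \<partial>lborel)"
    by (rule lborel_pair.Fubini') measurable
  also have "\<dots> = (\<integral>\<^sup>+s. I * k s \<partial>lborel)"
  proof (rule nn_integral_cong)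
    fix s :: real
    have "(\<integral>\<^sup>+t. ennreal_powr (\<phi> (t * s)) q * (ennreal (s powr (q / p)) * k s) * W t \<partial>lborel)
      = (\<integral>\<^sup>+t. (ennreal (s powr (q / p)) * k s) * (ennreal_powr (\<phi> (t * s)) q * W t) \<partial>lborel)"
      by (intro nn_integral_cong) (simp add: mult.commute mult.left_commute)
    also have "\<dots> = (ennreal (s powr (q / p)) * k s) * (\<integral>\<^sup>+t. ennreal_powr (\<phi> (t * s)) q * W t \<partial>lborel)"
      by (rule nn_integral_cmult) measurable
    also have "\<dots> = I * k s"
    proof (cases "0 < s")
      case True
      then show ?thesis unfolding scale[OF True, symmetric] by (simp add: ac_simps)
    qed (simp add: k_def)
    finally show "(\<integral>\<^sup>+t. ennreal_powr (\<phi> (t * s)) q * (ennreal (s powr (q / p)) * k s) * W t \<partial>lborel) = I * k s" .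
  qed
  also have "\<dots> = I * (\<integral>\<^sup>+s. k s \<partial>lborel)" by (rule nn_integral_cmult) measurable
  also have "ennreal (c powr (q - 1)) * \<dots> \<le> ennreal (c powr (q - 1)) * (I * ennreal c)"
    using k by (intro mult_left_mono) auto
  also have "\<dots> = ennreal (c powr (q - 1) * c) * I"
    using \<open>0 < c\<close> by (simp add: ennreal_mult ac_simps)
  also have "c powr (q - 1) * c = c powr q"
    using \<open>0 < c\<close> by (simp add: powr_diff)
  finally have "ennreal_powr (\<integral>\<^sup>+t. ennreal_powr (\<integral>\<^sup>+s\<in>{0<..<1}. \<phi> (t * s) \<partial>lborel) q * W t \<partial>lborel) (1 / q)
    \<le> ennreal_powr (ennreal (c powr q) * I) (1 / q)"
    using assms(2) by (intro ennreal_powr_mono) auto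
  also have "\<dots> = ennreal c * ennreal_powr I (1 / q)"
    using assms(2) \<open>0 < c\<close> by (simp add: ennreal_powr_mult powr_powr)
  finally show ?thesis using assms(2)
    by (simp add: lorentz_functional_finite I_def W_def c_def)
qed

lemma hardy_inequality:
  assumes "1 < p" "1 \<le> q" "\<phi> \<in> borel_measurable borel"
  shows "lorentz_functional p q (\<lambda>t. \<integral>\<^sup>+s\<in>{0<..<1}. \<phi> (t * s) \<partial>lborel)
    \<le> ennreal (p / (p - 1)) * lorentz_functional p q \<phi>"
  using assms by (cases q) (auto intro: hardy_inequality_top hardy_inequality_finite)

section \<open>Lorentz norms\<close>

lemma lorentz_norm_mono:
  assumes "f \<in> borel_measurable X" "g \<in> borel_measurable X" "AE x in X. \<bar>f x\<bar> \<le> \<bar>g x\<bar>"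
  shows "lorentz_norm X p q f \<le> lorentz_norm X p q g"
  unfolding lorentz_norm_eq_functional
  by (intro lorentz_functional_mono rearrangement_mono assms)

lemma rearrangement_zero [simp]: "decreasing_rearrangement X (\<lambda>x. 0) = (\<lambda>t. 0)"
proof
  fix t
  show "decreasing_rearrangement X (\<lambda>x. 0) t = 0"
    using rearrangement_indicator[of "{}" X t] by (simp add: indicator_def[abs_def])
qed

lemma lorentz_norm_zero [simp]: "lorentz_norm X p q (\<lambda>x. 0) = 0"
  by (simp add: lorentz_norm_eq_functional lorentz_functional_zero)

lemma lorentz_norm_cmult:
  assumes "0 < q" "f \<in> borel_measurable X" "0 < c"
  shows "lorentz_norm X p q (\<lambda>x. c * f x) = ennreal c * lorentz_norm X p q f"
proof -
  have "decreasing_rearrangement X (\<lambda>x. c * f x) = (\<lambda>t. ennreal c * decreasing_rearrangement X f t)"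
    using assms(2,3) by (intro ext rearrangement_cmult)
  then show ?thesis using assms(1)
    by (simp add: lorentz_norm_eq_functional lorentz_functional_cmult)
qed

lemma lorentz_norm_powr:
  assumes "0 < q" "0 < a" "f \<in> borel_measurable X"
  shows "lorentz_norm X (p / a) (q / ennreal a) (\<lambda>x. \<bar>f x\<bar> powr a) = ennreal_powr (lorentz_norm X p q f) a"
proof -
  have "decreasing_rearrangement X (\<lambda>x. \<bar>f x\<bar> powr a) = (\<lambda>t. ennreal_powr (decreasing_rearrangement X f t) a)"
    using assms(2,3) by (intro ext rearrangement_powr)
  then show ?thesis using assms(1,2)
    by (simp add: lorentz_norm_eq_functional lorentz_functional_powr)
qed

lemma lorentz_norm_SUP:
  assumes "0 < q" and fs: "\<And>n. fs n \<in> borel_measurable X" and f: "f \<in> borel_measurable X"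
    and mono: "\<And>n. AE x in X. \<bar>fs n x\<bar> \<le> \<bar>fs (Suc n) x\<bar>"
    and lim: "AE x in X. (\<lambda>n. \<bar>fs n x\<bar>) \<longlonglongrightarrow> \<bar>f x\<bar>"
  shows "lorentz_norm X p q f = (SUP n. lorentz_norm X p q (fs n))"
proof -
  have "decreasing_rearrangement X f = (\<lambda>t. SUP n. decreasing_rearrangement X (fs n) t)"
    using rearrangement_SUP[OF fs f _ lim] mono by (auto simp: AE_all_countable)
  then show ?thesis
    unfolding lorentz_norm_eq_functional using assms(1)
    by (simp add: lorentz_functional_SUP rearrangement_mono[OF fs fs mono])
qed

text \<open>For \<open>q \<le> p\<close> the weight \<open>t powr (q / p - 1)\<close> is decreasing,
  so the \<open>q\<close>-th power of the norm is a subadditive functional \<open>\<Lambda>\<close>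
  of \<open>\<bar>f\<bar> powr q\<close>. Applying \<open>\<Lambda>\<close> to the weighted
  convexity bound at fixed \<open>\<theta>\<close>, and optimising only afterwards, yields the
  constant 1.\<close>

lemma lorentz_norm_triangle:
  assumes X: "sigma_finite_measure X" and "1 \<le> q" "q \<le> p"
    and f [measurable]: "f \<in> borel_measurable X" and g [measurable]: "g \<in> borel_measurable X"
  shows "lorentz_norm X p (ennreal q) (\<lambda>x. f x + g x)
    \<le> lorentz_norm X p (ennreal q) f + lorentz_norm X p (ennreal q) g"
proof -
  define a where "a = q / p"
  have "a \<le> 1" using assms by (simp add: a_def)
  define \<Lambda> where "\<Lambda> h = (\<integral>\<^sup>+t\<in>{0<..}. decreasing_rearrangement X h t * ennreal (t powr (a - 1)) \<partial>lborel)" for h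
  have norm_eq: "lorentz_norm X p (ennreal q) h = ennreal_powr (\<Lambda> (\<lambda>x. \<bar>h x\<bar> powr q)) (1 / q)"
    if "h \<in> borel_measurable X" for h
    using assms(2) that
    by (simp add: lorentz_norm_eq_functional lorentz_functional_finite \<Lambda>_def rearrangement_powr a_def mult.assoc)
  have \<Lambda>_cmult: "\<Lambda> (\<lambda>x. c * h x) = ennreal c * \<Lambda> h" if "0 < c" "h \<in> borel_measurable X" for c h
    using that by (simp add: \<Lambda>_def rearrangement_cmult mult.assoc nn_integral_cmult)
  have "ennreal_powr (\<Lambda> (\<lambda>x. \<bar>f x + g x\<bar> powr q)) (1 / q)
    \<le> lorentz_norm X p (ennreal q) f + lorentz_norm X p (ennreal q) g"
  proof (rule minkowski_from_weighted[OF assms(2)])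
    fix \<theta> :: real assume \<theta>: "0 < \<theta>" "\<theta> < 1"
    let ?F = "\<lambda>x. \<theta> powr (1 - q) * \<bar>f x\<bar> powr q"
    let ?G = "\<lambda>x. (1 - \<theta>) powr (1 - q) * \<bar>g x\<bar> powr q"
    have "\<bar>f x + g x\<bar> powr q \<le> ?F x + ?G x" for x
    proof -
      have "\<bar>f x + g x\<bar> powr q \<le> (\<bar>f x\<bar> + \<bar>g x\<bar>) powr q"
        using assms(2) by (intro powr_mono2) auto
      also have "\<dots> \<le> ?F x + ?G x"
        using \<theta> assms(2) by (intro powr_add_le_weighted) auto
      finally show ?thesis .
    qed
    then have "\<Lambda> (\<lambda>x. \<bar>f x + g x\<bar> powr q) \<le> \<Lambda> (\<lambda>x. ?F x + ?G x)"
      unfolding \<Lambda>_def by (intro nn_integral_mono mult_right_mono rearrangement_mono AE_I2) auto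
    also have "\<dots> \<le> \<Lambda> ?F + \<Lambda> ?G"
      unfolding \<Lambda>_def using \<open>a \<le> 1\<close> by (intro weighted_rearrangement_integral_subadd X) auto
    finally show "\<Lambda> (\<lambda>x. \<bar>f x + g x\<bar> powr q)
      \<le> ennreal (\<theta> powr (1 - q)) * ennreal_powr (lorentz_norm X p (ennreal q) f) q
        + ennreal ((1 - \<theta>) powr (1 - q)) * ennreal_powr (lorentz_norm X p (ennreal q) g) q"
      using \<theta> assms(2) by (simp add: \<Lambda>_cmult norm_eq)
  qed
  then show ?thesis by (simp add: norm_eq)
qed

lemma lorentz_norm_sum_le:
  assumes X: "sigma_finite_measure X" and "1 \<le> q" "q \<le> p"
    and "finite J" and "\<And>j. j \<in> J \<Longrightarrow> h j \<in> borel_measurable X"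
  shows "lorentz_norm X p (ennreal q) (\<lambda>x. \<Sum>j\<in>J. h j x) \<le> (\<Sum>j\<in>J. lorentz_norm X p (ennreal q) (h j))"
  using assms(4,5)
proof (induction J rule: finite_induct)
  case (insert i J)
  then have "lorentz_norm X p (ennreal q) (\<lambda>x. h i x + (\<Sum>j\<in>J. h j x))
      \<le> lorentz_norm X p (ennreal q) (h i) + lorentz_norm X p (ennreal q) (\<lambda>x. \<Sum>j\<in>J. h j x)"
    by (intro lorentz_norm_triangle X assms(2,3)) auto
  also have "\<dots> \<le> lorentz_norm X p (ennreal q) (h i) + (\<Sum>j\<in>J. lorentz_norm X p (ennreal q) (h j))"
    using insert by (intro add_left_mono) auto
  finally show ?case using insert by simp
qed simp

text \<open>This is \<open>f\<^sup>*\<^sup>*\<close>, the mean of the rearrangement over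
  \<open>(0, t)\<close>, rescaled to the unit interval; in this form it is a superposition of
  dilates, as Hardy's inequality requires.\<close>

definition rearrangement_average :: "'a measure \<Rightarrow> ('a \<Rightarrow> real) \<Rightarrow> real \<Rightarrow> ennreal" where
  "rearrangement_average X f t = (\<integral>\<^sup>+s\<in>{0<..<1}. decreasing_rearrangement X f (t * s) \<partial>lborel)"

lemma borel_measurable_rearrangement_average [measurable]:
  "rearrangement_average X f \<in> borel_measurable borel"
  unfolding rearrangement_average_def[abs_def] by measurable

lemma rearrangement_le_average:
  assumes "0 < t"
  shows "decreasing_rearrangement X f t \<le> rearrangement_average X f t"
proof -
  have "decreasing_rearrangement X f t = (\<integral>\<^sup>+s. decreasing_rearrangement X f t * indicator {0<..<1::real} s \<partial>lborel)"
    by (simp add: nn_integral_cmult)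
  also have "\<dots> \<le> rearrangement_average X f t"
    unfolding rearrangement_average_def using assms
    by (intro nn_integral_mono) (auto simp: indicator_def intro!: rearrangement_antimono)
  finally show ?thesis .
qed

lemma rearrangement_integral_eq_average:
  assumes "0 < u"
  shows "(\<integral>\<^sup>+t\<in>{0<..<u}. decreasing_rearrangement X f t \<partial>lborel) = ennreal u * rearrangement_average X f u"
proof -
  have "(\<integral>\<^sup>+t\<in>{0<..<u}. decreasing_rearrangement X f t \<partial>lborel)
      = ennreal \<bar>u\<bar> * (\<integral>\<^sup>+s. decreasing_rearrangement X f (0 + u * s) * indicator {0<..<u} (0 + u * s) \<partial>lborel)"
    using assms by (intro nn_integral_real_affine) auto
  also have "(\<integral>\<^sup>+s. decreasing_rearrangement X f (0 + u * s) * indicator {0<..<u} (0 + u * s) \<partial>lborel)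
      = rearrangement_average X f u"
    unfolding rearrangement_average_def using assms
    by (intro nn_integral_cong) (auto simp: indicator_def zero_less_mult_iff)
  finally show ?thesis using assms by simp
qed

lemma rearrangement_average_subadd:
  assumes X: "sigma_finite_measure X" and "0 < t"
    and "f \<in> borel_measurable X" "g \<in> borel_measurable X"
  shows "rearrangement_average X (\<lambda>x. f x + g x) t \<le> rearrangement_average X f t + rearrangement_average X g t"
  using rearrangement_integral_subadd[OF X assms(3,4), of t] \<open>0 < t\<close>
  by (simp add: rearrangement_integral_eq_average distrib_left[symmetric] ennreal_mult_le_mult_iff)

text \<open>The norm is replaced by its averaged version before any addition takes place, and
  Hardy's inequality returns from it for each summand separately. Hence the constant does not depend
  on the size of \<open>J\<close>.\<close>

lemma lorentz_norm_sum_quasi: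
  assumes X: "sigma_finite_measure X" and "1 < p" "1 \<le> q"
    and "finite J" and h: "\<And>j. j \<in> J \<Longrightarrow> h j \<in> borel_measurable X"
  shows "lorentz_norm X p q (\<lambda>x. \<Sum>j\<in>J. h j x) \<le> ennreal (p / (p - 1)) * (\<Sum>j\<in>J. lorentz_norm X p q (h j))"
proof -
  let ?N = "\<lambda>f. lorentz_functional p q (rearrangement_average X f)"
  have "lorentz_norm X p q (\<lambda>x. \<Sum>j\<in>J. h j x) \<le> ?N (\<lambda>x. \<Sum>j\<in>J. h j x)"
    unfolding lorentz_norm_eq_functional by (intro lorentz_functional_mono rearrangement_le_average)
  also have "\<dots> \<le> (\<Sum>j\<in>J. ?N (h j))"
    using assms(4,5)
  proof (induction J rule: finite_induct)
    case empty
    then show ?case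
      by (simp add: rearrangement_average_def[abs_def] lorentz_functional_zero)
  next
    case (insert i J)
    then have "?N (\<lambda>x. h i x + (\<Sum>j\<in>J. h j x))
        \<le> lorentz_functional p q (\<lambda>t. rearrangement_average X (h i) t + rearrangement_average X (\<lambda>x. \<Sum>j\<in>J. h j x) t)"
      by (intro lorentz_functional_mono rearrangement_average_subadd X) auto
    also have "\<dots> \<le> ?N (h i) + ?N (\<lambda>x. \<Sum>j\<in>J. h j x)"
      using \<open>1 \<le> q\<close> by (intro lorentz_functional_triangle) auto
    also have "\<dots> \<le> ?N (h i) + (\<Sum>j\<in>J. ?N (h j))"
      using insert by (intro add_left_mono) auto
    finally show ?case using insert by simp
  qed
  also have "\<dots> \<le> (\<Sum>j\<in>J. ennreal (p / (p - 1)) * lorentz_norm X p q (h j))"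
    unfolding lorentz_norm_eq_functional rearrangement_average_def[abs_def]
    using assms(2,3) by (intro sum_mono hardy_inequality) auto
  finally show ?thesis by (simp add: sum_distrib_left)
qed

text \<open>At a fixed \<open>t\<close> the rearranged indicator of \<open>A j\<close> is 1 or 0,
  according to whether the measure of \<open>A j\<close> exceeds \<open>t\<close>. The last layer
  with value 1 decides: the weights up to it telescope to the \<open>q\<close>-th power of its
  level, and the rearrangement of \<open>g\<close> at \<open>t\<close> is at least that
  level.\<close>

lemma lorentz_norm_layers_le:
  assumes [measurable]: "g \<in> borel_measurable X" and "0 < q" and a: "strict_mono a" "a 0 = 0"
  shows "(\<Sum>j<N. ennreal (a (Suc j) powr q - a j powr q) *
      ennreal_powr (lorentz_norm X p (ennreal q) (indicator {x \<in> space X. a (Suc j) \<le> \<bar>g x\<bar>})) q)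
    \<le> ennreal_powr (lorentz_norm X p (ennreal q) g) q"
proof -
  define A where "A j = {x \<in> space X. a (Suc j) \<le> \<bar>g x\<bar>}" for j
  have [measurable]: "A j \<in> sets X" for j unfolding A_def by measurable
  define b where "b j = ennreal (a (Suc j) powr q - a j powr q)" for j
  define W where "W t = ennreal (t powr (q / p - 1)) * indicator {0<..} t" for t :: real
  have [measurable]: "W \<in> borel_measurable borel" unfolding W_def by measurable
  have norm_eq: "ennreal_powr (lorentz_norm X p (ennreal q) f) q
    = (\<integral>\<^sup>+t. ennreal_powr (decreasing_rearrangement X f t) q * W t \<partial>lborel)" for f
    using \<open>0 < q\<close> by (simp add: lorentz_norm_eq_functional lorentz_functional_finite W_def)
  have a_nonneg: "0 \<le> a j" for j
    using strict_mono_less_eq[OF a(1), of 0 j] a(2) by simp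
  have a_powr_mono: "a j powr q \<le> a (Suc j) powr q" for j
    using a_nonneg \<open>0 < q\<close> strict_mono_less_eq[OF a(1), of j "Suc j"] by (intro powr_mono2) auto
  have pointwise: "(\<Sum>j<N. b j * ennreal_powr (decreasing_rearrangement X (indicator (A j)) t) q)
    \<le> ennreal_powr (decreasing_rearrangement X g t) q" for t
  proof (induction N)
    case (Suc N)
    show ?case
    proof (cases "ennreal t < emeasure X (A N)")
      case True
      have "(\<Sum>j<Suc N. b j * ennreal_powr (decreasing_rearrangement X (indicator (A j)) t) q) \<le> (\<Sum>j<Suc N. b j)"
      proof (rule sum_mono)
        fix j
        have "ennreal_powr (decreasing_rearrangement X (indicator (A j)) t) q \<le> 1"
          using ennreal_powr_ennreal[of 1 q] by (simp add: rearrangement_indicator)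
        then show "b j * ennreal_powr (decreasing_rearrangement X (indicator (A j)) t) q \<le> b j"
          using mult_left_mono[of _ 1 "b j"] by simp
      qed
      also have "(\<Sum>j<Suc N. b j) = ennreal (\<Sum>j<Suc N. a (Suc j) powr q - a j powr q)"
        unfolding b_def using a_powr_mono by (intro sum_ennreal) simp
      also have "\<dots> = ennreal_powr (ennreal (a (Suc N))) q"
        using \<open>0 < q\<close> a(2) a_nonneg by (subst sum_lessThan_telescope) simp
      also have "ennreal (a (Suc N)) \<le> decreasing_rearrangement X g t"
      proof (rule ennreal_le_via_less)
        fix s :: real assume s: "0 \<le> s" "ennreal s < ennreal (a (Suc N))"
        note True
        also have "emeasure X (A N) \<le> distribution_function X g s"
          unfolding distribution_function_def A_def using s
          by (intro emeasure_mono) (auto simp: ennreal_less_iff)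
        finally show "ennreal s < decreasing_rearrangement X g t"
          using s(1) by (simp add: less_rearrangement_iff)
      qed
      finally show ?thesis using \<open>0 < q\<close> by (simp add: ennreal_powr_mono)
    next
      case False
      then show ?thesis using Suc by (simp add: rearrangement_indicator)
    qed
  qed simp
  have "(\<Sum>j<N. b j * ennreal_powr (lorentz_norm X p (ennreal q) (indicator (A j))) q)
    = (\<integral>\<^sup>+t. (\<Sum>j<N. b j * ennreal_powr (decreasing_rearrangement X (indicator (A j)) t) q) * W t \<partial>lborel)"
    by (simp add: norm_eq sum_distrib_right nn_integral_sum nn_integral_cmult mult.assoc)
  also have "\<dots> \<le> ennreal_powr (lorentz_norm X p (ennreal q) g) q"
    unfolding norm_eq by (intro nn_integral_mono mult_right_mono pointwise) simp
  finally show ?thesis by (simp add: A_def b_def)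
qed

section \<open>Level decompositions\<close>

text \<open>Concavity in increment form: the increment over a fixed step \<open>d\<close> has
  nonpositive derivative because \<open>t powr (q - 1)\<close> decreases. The power need not be
  differentiable at 0, so derivatives are taken in the open interval only, with continuity up to the
  end points.\<close>

lemma powr_increment_antimono:
  fixes x y d q :: real
  assumes "0 < q" "q \<le> 1" "0 \<le> y" "y \<le> x" "0 \<le> d"
  shows "(x + d) powr q - x powr q \<le> (y + d) powr q - y powr q"
proof (cases "q = 1 \<or> d = 0")
  case True
  then show ?thesis using assms by auto
next
  case False
  then have "q < 1" "0 < d" using assms by auto
  define F where "F t = (t + d) powr q - t powr q" for t
  show ?thesis
  proof (cases "x = y")
    case False
    then have "y < x" using assms by simp
    have "F x \<le> F y"
    proof (rule DERIV_nonpos_imp_decreasing_open[OF assms(4)])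
      fix t assume t: "y < t" "t < x"
      then have "0 < t" using assms by simp
      then have "(F has_real_derivative (q * (t + d) powr (q - 1) - q * t powr (q - 1))) (at t)"
        unfolding F_def using \<open>0 < d\<close> by (auto intro!: derivative_eq_intros)
      moreover have "(t + d) powr (q - 1) \<le> t powr (q - 1)"
        using \<open>0 < t\<close> \<open>0 < d\<close> \<open>q < 1\<close> by (intro powr_mono2') auto
      ultimately show "\<exists>D. (F has_real_derivative D) (at t) \<and> D \<le> 0"
        using assms(1) by (intro exI[of _ "q * (t + d) powr (q - 1) - q * t powr (q - 1)"]) (auto intro: mult_left_mono)
    next
      show "continuous_on {y..x} F"
        unfolding F_def using assms by (intro continuous_intros continuous_on_powr') auto
    qed
    then show ?thesis by (simp add: F_def)
  qed simp
qed

text \<open>For constant \<open>h\<close> both sides agree. The induction compares with that case: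
  the partial sum is at least \<open>a N * h N\<close>, by concavity the next term adds most at this
  smaller base, and there the gain factors into the weight times \<open>h N powr q\<close>.\<close>

lemma sum_increments_powr_le:
  fixes a h :: "nat \<Rightarrow> real"
  assumes q: "0 < q" "q \<le> 1" and a: "mono a" "a 0 = 0"
    and h: "\<And>j. 0 \<le> h j" "\<And>j. h (Suc j) \<le> h j"
  shows "(\<Sum>j<N. (a (Suc j) - a j) * h j) powr q \<le> (\<Sum>j<N. (a (Suc j) powr q - a j powr q) * h j powr q)"
proof (induction N)
  case (Suc N)
  let ?S = "\<Sum>j<N. (a (Suc j) - a j) * h j"
  have aN: "0 \<le> a N" "a N \<le> a (Suc N)" using monoD[OF a(1), of 0 N] monoD[OF a(1), of N "Suc N"] a(2) by auto
  have "h N \<le> h j" if "j \<le> N" for j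
    by (rule lift_Suc_antimono_le[of h, OF h(2) that])
  \<comment> \<open>All values are lowered to the last one, after which the increments telescope to
    \<open>a N\<close>.\<close>
  then have "(\<Sum>j<N. (a (Suc j) - a j) * h N) \<le> ?S"
    using monoD[OF a(1)] by (intro sum_mono mult_left_mono) auto
  then have S: "a N * h N \<le> ?S"
    by (simp add: sum_distrib_right[symmetric] sum_lessThan_telescope a(2))
  have "(?S + (a (Suc N) - a N) * h N) powr q - ?S powr q
      \<le> (a N * h N + (a (Suc N) - a N) * h N) powr q - (a N * h N) powr q"
    using aN h(1) S by (intro powr_increment_antimono q) auto
  also have "a N * h N + (a (Suc N) - a N) * h N = a (Suc N) * h N" by (simp add: algebra_simps)
  also have "(a (Suc N) * h N) powr q - (a N * h N) powr q = (a (Suc N) powr q - a N powr q) * h N powr q"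
    using aN h(1) by (simp add: powr_mult algebra_simps)
  finally show ?case using Suc by simp
qed simp

text \<open>The levels continue strictly increasing beyond the largest element of the set, so that
  positivity of increments holds at every index without a bound.\<close>

lemma finite_nonneg_set_levels:
  fixes V :: "real set"
  assumes "finite V" "\<And>v. v \<in> V \<Longrightarrow> 0 \<le> v"
  shows "\<exists>a N. strict_mono (a :: nat \<Rightarrow> real) \<and> a 0 = 0 \<and> a ` {..N} = insert 0 V"
  using assms
proof (induction V rule: finite_linorder_max_induct)
  case empty
  show ?case by (rule exI[of _ real], rule exI[of _ 0]) (auto simp: strict_mono_def)
next
  case (insert b V)
  then obtain a :: "nat \<Rightarrow> real" and N where a: "strict_mono a" "a 0 = 0" "a ` {..N} = insert 0 V"
    by auto
  show ?case
  proof (cases "b = 0")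
    case True
    then show ?thesis using a by auto
  next
    case False
    then have "0 < b" using insert.prems by (simp add: less_le)
    have "a N \<in> insert 0 V" using a(3) by blast
    then have "a N < b" using \<open>0 < b\<close> insert.hyps by auto
    \<comment> \<open>The new maximum \<open>b\<close> takes the index \<open>Suc N\<close>; unit
      steps replace the old tail, whose values might not exceed \<open>b\<close>.\<close>
    define a' where "a' j = (if j \<le> N then a j else b + real (j - Suc N))" for j
    have "a' j < a' (Suc j)" for j
    proof (cases "j < N")
      case True
      then show ?thesis using a(1) by (simp add: a'_def strict_mono_def)
    next
      case False
      then show ?thesis using \<open>a N < b\<close> by (cases "j = N") (auto simp: a'_def)
    qed
    then have "strict_mono a'" by (simp add: strict_mono_Suc_iff)
    moreover have "a' ` {..Suc N} = insert b (a ` {..N})"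
      by (auto simp: atMost_Suc a'_def intro!: image_cong)
    moreover have "a' 0 = 0" using a(2) by (simp add: a'_def)
    moreover have "insert b (a ` {..N}) = insert 0 (insert b V)" using a(3) by auto
    ultimately have "strict_mono a' \<and> a' 0 = 0 \<and> a' ` {..Suc N} = insert 0 (insert b V)" by simp
    then show ?thesis by blast
  qed
qed

text \<open>A zero denominator is harmless: the quotient is infinite unless \<open>x = 0\<close>. An
  infinite denominator has to be excluded, since the quotient is then 0 for every \<open>x\<close>
  and says nothing when \<open>M = 0\<close>.\<close>

lemma ennreal_le_mult_if_divide_le:
  fixes x y M :: ennreal
  assumes "x / y \<le> M" "M < top" "y < top"
  shows "x \<le> M * y"
proof (cases "y = 0")
  case True
  then show ?thesis using assms by (cases "x = 0") (auto simp: divide_ennreal_def ennreal_mult_top)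
next
  case False
  then have "x = x * (y / y)" using assms(3) by simp
  also have "\<dots> = x / y * y" by (simp only: divide_ennreal_def mult_ac)
  also have "\<dots> \<le> M * y" by (rule mult_right_mono[OF assms(1)]) simp
  finally show ?thesis .
qed

text \<open>A quotient by \<open>top\<close> is 0, so functions of infinite norm need no
  estimate.\<close>

lemma ennreal_divide_le_if_le_mult:
  fixes x y K :: ennreal
  assumes "y < top \<Longrightarrow> x \<le> K * y"
  shows "x / y \<le> K"
proof (cases "y = top \<or> y = 0")
  case True
  then show ?thesis using assms by auto
next
  case False
  then have y: "y < top" "y \<noteq> 0" by (simp_all add: less_top[symmetric])
  then have "x / y \<le> K * y / y"
    using assms by (intro divide_right_mono_ennreal) simp
  also have "\<dots> = K * (y / y)" by (simp only: ennreal_times_divide)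
  also have "\<dots> = K" using y by simp
  finally show ?thesis .
qed

section \<open>Operators of restricted type\<close>

lemma regular_class_abs:
  assumes "regular_class X L" "f \<in> L"
  shows "(\<lambda>x. \<bar>f x\<bar>) \<in> L"
proof -
  have "(\<lambda>x. \<bar>1 * f x\<bar>) \<in> L" using assms unfolding regular_class_def by blast
  then show ?thesis by simp
qed

lemma regular_class_indicator:
  assumes "regular_class X L" "f \<in> L" "0 < t"
  shows "indicator {x \<in> space X. t < \<bar>f x\<bar>} \<in> L"
  using assms unfolding regular_class_def by blast

lemma regular_class_approx:
  assumes "regular_class X L" "f \<in> L"
  obtains fs :: "nat \<Rightarrow> 'a \<Rightarrow> real" where
    "\<And>n. fs n \<in> L" "\<And>n. simple_function X (fs n)"
    "AE x in X. (\<forall>n. 0 \<le> fs n x \<and> fs n x \<le> fs (Suc n) x) \<and> (\<lambda>n. fs n x) \<longlonglongrightarrow> \<bar>f x\<bar>"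
proof -
  from assms(1)[unfolded regular_class_def, THEN conjunct2, THEN conjunct2, THEN bspec, OF assms(2),
      THEN conjunct2, THEN conjunct2]
  show thesis
  proof (elim exE conjE)
    fix fs :: "nat \<Rightarrow> 'a \<Rightarrow> real"
    assume "\<forall>n. fs n \<in> L \<and> simple_function X (fs n)"
      and *: "AE x in X. (\<forall>n. 0 \<le> fs n x \<and> fs n x \<le> fs (Suc n) x) \<and> (\<lambda>n. fs n x) \<longlonglongrightarrow> \<bar>f x\<bar>"
    then show thesis by (intro that[OF _ _ *]) simp_all
  qed
qed

lemma monotone_opD:
  assumes "monotone_op X L Y T" "f \<in> L" "g \<in> L" "AE x in X. \<bar>f x\<bar> \<le> \<bar>g x\<bar>"
  shows "AE y in Y. \<bar>T f y\<bar> \<le> \<bar>T g y\<bar>"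
  using assms(1)[unfolded monotone_op_def, rule_format, OF assms(2-4)] .

lemma order_continuous_opD:
  assumes "order_continuous_op X L Y T" "f \<in> L" "\<And>n. fs n \<in> L"
    and "AE x in X. (\<forall>n. 0 \<le> fs n x \<and> fs n x \<le> fs (Suc n) x) \<and> (\<lambda>n. fs n x) \<longlonglongrightarrow> f x"
  shows "AE y in Y. (\<lambda>n. \<bar>T (fs n) y\<bar>) \<longlonglongrightarrow> \<bar>T f y\<bar>"
proof -
  have "\<forall>n. fs n \<in> L" using assms(3) ..
  from assms(1)[unfolded order_continuous_op_def, THEN conjunct2, THEN spec, THEN bspec, OF assms(2),
      THEN mp, OF this, THEN mp, OF assms(4)]
  show ?thesis .
qed

text \<open>\<open>K\<close> stands for the constant in the triangle inequality for arbitrarily many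
  summands at the exponents divided by \<open>q0\<close>; both cases of the theorem then share one
  argument. It acts on the \<open>q0\<close>-th power of the norm, hence the root in the
  conclusion.\<close>

lemma restricted_type_simple:
  fixes X :: "'a measure" and Y :: "'b measure" and T :: "('a \<Rightarrow> real) \<Rightarrow> 'b \<Rightarrow> real"
    and q1 :: ennreal
  assumes L: "regular_class X L" and T: "T \<in> L \<rightarrow> measurable_functions Y"
    and mono: "monotone_op X L Y T" and sub: "sublinear_op L Y T"
    and q0: "0 < q0" "q0 \<le> 1" and "0 < q1"
    and quasi: "\<And>(J :: nat set) h. finite J \<Longrightarrow> (\<And>j. j \<in> J \<Longrightarrow> h j \<in> borel_measurable Y) \<Longrightarrow>
      lorentz_norm Y (p1 / q0) (q1 / ennreal q0) (\<lambda>y. \<Sum>j\<in>J. h j y)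
        \<le> K * (\<Sum>j\<in>J. lorentz_norm Y (p1 / q0) (q1 / ennreal q0) (h j))"
    and restricted: "\<And>B. B \<in> sets X \<Longrightarrow> indicator B \<in> L \<Longrightarrow>
      lorentz_norm X p0 (ennreal q0) (indicator B) < top \<Longrightarrow>
      lorentz_norm Y p1 q1 (T (indicator B)) \<le> M * lorentz_norm X p0 (ennreal q0) (indicator B)"
    and g: "g \<in> L" "simple_function X g" "lorentz_norm X p0 (ennreal q0) g < top"
  shows "lorentz_norm Y p1 q1 (T g) \<le> ennreal_powr K (1 / q0) * M * lorentz_norm X p0 (ennreal q0) g"
proof -
  let ?normX = "lorentz_norm X p0 (ennreal q0)" and ?normY = "lorentz_norm Y p1 q1"
    and ?normQ = "lorentz_norm Y (p1 / q0) (q1 / ennreal q0)"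
  have T_meas [measurable]: "T f \<in> borel_measurable Y" if "f \<in> L" for f
    using T that by (auto simp: measurable_functions_def)
  have g_meas [measurable]: "g \<in> borel_measurable X" and g_off: "\<And>x. x \<notin> space X \<Longrightarrow> g x = 0"
    using L g(1) by (auto simp: regular_class_def measurable_functions_def)
  have abs_g: "(\<lambda>x. \<bar>g x\<bar>) \<in> L" by (rule regular_class_abs[OF L g(1)])

  \<comment> \<open>The value 1 is added to the levels so that \<open>N \<noteq> 0\<close> even for
    \<open>g = 0\<close>: sublinearity is available only for sums of at least one term.\<close>
  obtain a :: "nat \<Rightarrow> real" and N where a: "strict_mono a" "a 0 = 0"
    and levels: "a ` {..N} = insert 0 (insert 1 ((\<lambda>x. \<bar>g x\<bar>) ` space X))"
  proof -
    have "(\<lambda>x. \<bar>g x\<bar>) ` space X = abs ` (g ` space X)" by auto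
    then have "finite (insert 1 ((\<lambda>x. \<bar>g x\<bar>) ` space X))"
      using simple_functionD(1)[OF g(2)] by simp
    then have "\<exists>(a :: nat \<Rightarrow> real) N. strict_mono a \<and> a 0 = 0 \<and> a ` {..N} = insert 0 (insert 1 ((\<lambda>x. \<bar>g x\<bar>) ` space X))"
      by (rule finite_nonneg_set_levels) auto
    then show ?thesis using that by blast
  qed
  have "N \<noteq> 0"
  proof
    assume "N = 0"
    then have "insert 0 (insert 1 ((\<lambda>x. \<bar>g x\<bar>) ` space X)) = {0}" using levels a(2) by simp
    then show False by auto
  qed
  have level: "\<exists>k\<le>N. \<bar>g x\<bar> = a k" if "x \<in> space X" for x
  proof -
    have "\<bar>g x\<bar> \<in> a ` {..N}" unfolding levels using that by simp
    then show ?thesis by auto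
  qed
  note a_le = strict_mono_less_eq[OF a(1)] and a_less = strict_mono_less[OF a(1)]
  have a_nonneg: "0 \<le> a j" for j using a_le[of 0 j] a(2) by simp

  define A where "A j = {x \<in> space X. a (Suc j) \<le> \<bar>g x\<bar>}" for j
  have A_sets [measurable]: "A j \<in> sets X" for j unfolding A_def by measurable
  have A_L: "indicator (A j) \<in> L" for j
  proof -
    \<comment> \<open>The class provides strict superlevel sets at positive heights only, while
      \<open>a 0 = 0\<close>. As \<open>\<bar>g\<bar>\<close> takes only the values
      \<open>a k\<close>, none lies strictly between neighbouring levels, and the midpoint serves
      every \<open>j\<close>.\<close>
    let ?m = "(a j + a (Suc j)) / 2"
    have m: "a j < ?m" "?m < a (Suc j)" using a_less[of j "Suc j"] by auto
    have "A j = {x \<in> space X. ?m < \<bar>g x\<bar>}"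
    proof (intro set_eqI iffI)
      fix x assume "x \<in> {x \<in> space X. ?m < \<bar>g x\<bar>}"
      then have x: "x \<in> space X" "?m < \<bar>g x\<bar>" by auto
      then obtain k where k: "\<bar>g x\<bar> = a k" using level by blast
      then have "a j < a k" using m(1) x(2) by linarith
      then have "a (Suc j) \<le> a k" using a_less a_le by (simp add: Suc_le_eq)
      then show "x \<in> A j" using x k by (simp add: A_def)
    qed (use m in \<open>auto simp: A_def\<close>)
    moreover have "indicator {x \<in> space X. ?m < \<bar>g x\<bar>} \<in> L"
      using m(1) a_nonneg[of j] by (intro regular_class_indicator[OF L g(1)]) linarith
    ultimately show ?thesis by (simp only:)
  qed
  \<comment> \<open>An identity on the whole type, off \<open>space X\<close> included, because
    \<open>sublinear_op\<close> speaks of the sum as a function.\<close>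
  have decomp: "(\<lambda>x. \<Sum>j<N. (a (Suc j) - a j) * indicator (A j) x) = (\<lambda>x. \<bar>g x\<bar>)"
  proof
    fix x
    show "(\<Sum>j<N. (a (Suc j) - a j) * indicator (A j) x) = \<bar>g x\<bar>"
    proof (cases "x \<in> space X")
      case True
      then obtain k where k: "k \<le> N" "\<bar>g x\<bar> = a k" using level by blast
      have "indicator (A j) x = (if j < k then 1 else 0 :: real)" for j
        using True by (simp add: A_def indicator_def k(2) a_le Suc_le_eq)
      then have "(\<Sum>j<N. (a (Suc j) - a j) * indicator (A j) x) = (\<Sum>j<N. if j < k then a (Suc j) - a j else 0)"
        by (intro sum.cong) auto
      also have "\<dots> = (\<Sum>j<k. a (Suc j) - a j)"
        using k(1) by (intro sum.mono_neutral_cong_right) auto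
      also have "\<dots> = \<bar>g x\<bar>" by (simp add: sum_lessThan_telescope a(2) k(2))
      finally show ?thesis .
    qed (simp add: A_def g_off)
  qed

  define h where "h j y = \<bar>T (indicator (A j)) y\<bar>" for j y
  have h_meas [measurable]: "h j \<in> borel_measurable Y" for j
    unfolding h_def[abs_def] using A_L by measurable
  define b where "b j = a (Suc j) powr q0 - a j powr q0" for j
  have b_pos: "0 < b j" for j
    using powr_less_mono2[OF q0(1) a_nonneg, of j "a (Suc j)"] a_less by (simp add: b_def)
  have "AE y in Y. h (Suc j) y \<le> h j y" for j
    unfolding h_def using a_le[of "Suc j" "Suc (Suc j)"]
    by (intro monotone_opD[OF mono] A_L) (auto simp: A_def indicator_def)
  then have h_anti: "AE y in Y. \<forall>j. h (Suc j) y \<le> h j y" by (simp add: AE_all_countable)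
  have T_abs: "AE y in Y. \<bar>T g y\<bar> \<le> \<bar>T (\<lambda>x. \<bar>g x\<bar>) y\<bar>"
    by (intro monotone_opD[OF mono] g(1) abs_g) simp
  have T_sub: "AE y in Y. \<bar>T (\<lambda>x. \<bar>g x\<bar>) y\<bar> \<le> (\<Sum>j<N. \<bar>(a (Suc j) - a j) * T (indicator (A j)) y\<bar>)"
  proof -
    have "1 \<le> N" using \<open>N \<noteq> 0\<close> by simp
    from sub[unfolded sublinear_op_def, rule_format, OF this,
        of "\<lambda>j. indicator (A j)" "\<lambda>j. a (Suc j) - a j", unfolded decomp, OF A_L abs_g]
    show ?thesis .
  qed
  have pointwise: "AE y in Y. \<bar>\<bar>T g y\<bar> powr q0\<bar> \<le> \<bar>\<Sum>j<N. b j * h j y powr q0\<bar>"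
    using h_anti T_abs T_sub
  proof eventually_elim
    case (elim y)
    have "\<bar>T g y\<bar> \<le> (\<Sum>j<N. (a (Suc j) - a j) * h j y)"
      using elim(2,3) a_le[of _ "Suc _"] by (simp add: h_def abs_mult)
    then have "\<bar>T g y\<bar> powr q0 \<le> (\<Sum>j<N. (a (Suc j) - a j) * h j y) powr q0"
      using q0 by (intro powr_mono2) auto
    also have "\<dots> \<le> (\<Sum>j<N. b j * h j y powr q0)"
      unfolding b_def using elim(1) q0 a strict_mono_mono[OF a(1)]
      by (intro sum_increments_powr_le) (auto simp: h_def)
    finally show ?case by simp
  qed

  have N0_le: "(\<Sum>j<N. ennreal (b j) * ennreal_powr (?normX (indicator (A j))) q0) \<le> ennreal_powr (?normX g) q0"
    unfolding b_def A_def using q0(1) a by (intro lorentz_norm_layers_le) auto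
  \<comment> \<open>The hypothesis \<open>restricted\<close> covers finite norms only; a layer of
    infinite norm would, with its positive weight \<open>b j\<close>, make the bounded sum
    infinite.\<close>
  have fin: "?normX (indicator (A j)) < top" if "j < N" for j
  proof -
    have "ennreal (b j) * ennreal_powr (?normX (indicator (A j))) q0
      \<le> (\<Sum>j<N. ennreal (b j) * ennreal_powr (?normX (indicator (A j))) q0)"
      using that by (intro member_le_sum) auto
    also note N0_le
    also have "ennreal_powr (?normX g) q0 < top"
      using g(3) by (cases "?normX g") auto
    finally show ?thesis using b_pos[of j]
      by (cases "?normX (indicator (A j))") (auto simp: ennreal_mult_top)
  qed

  have N_q: "0 < q1 / ennreal q0"
    using \<open>0 < q1\<close> by (simp add: ennreal_zero_less_divide)
  have "ennreal_powr (?normY (T g)) q0 = ?normQ (\<lambda>y. \<bar>T g y\<bar> powr q0)"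
    using \<open>0 < q1\<close> q0(1) g(1) by (intro lorentz_norm_powr[symmetric] T_meas)
  also have "\<dots> \<le> ?normQ (\<lambda>y. \<Sum>j<N. b j * h j y powr q0)"
    using pointwise T_meas[OF g(1)] by (intro lorentz_norm_mono) auto
  also have "\<dots> \<le> K * (\<Sum>j<N. ?normQ (\<lambda>y. b j * h j y powr q0))"
    by (intro quasi) auto
  also have "(\<Sum>j<N. ?normQ (\<lambda>y. b j * h j y powr q0)) = (\<Sum>j<N. ennreal (b j) * ennreal_powr (?normY (T (indicator (A j)))) q0)"
  proof (rule sum.cong[OF refl])
    fix j
    have "?normQ (\<lambda>y. b j * h j y powr q0) = ennreal (b j) * ?normQ (\<lambda>y. h j y powr q0)"
      using N_q b_pos by (intro lorentz_norm_cmult) auto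
    also have "?normQ (\<lambda>y. h j y powr q0) = ennreal_powr (?normY (T (indicator (A j)))) q0"
      unfolding h_def using \<open>0 < q1\<close> q0(1) A_L by (intro lorentz_norm_powr T_meas)
    finally show "?normQ (\<lambda>y. b j * h j y powr q0) = ennreal (b j) * ennreal_powr (?normY (T (indicator (A j)))) q0" .
  qed
  also have "\<dots> \<le> (\<Sum>j<N. ennreal (b j) * ennreal_powr (M * ?normX (indicator (A j))) q0)"
    using q0(1) fin by (intro sum_mono mult_left_mono ennreal_powr_mono restricted A_sets A_L) auto
  also have "\<dots> = ennreal_powr M q0 * (\<Sum>j<N. ennreal (b j) * ennreal_powr (?normX (indicator (A j))) q0)"
    using q0(1) by (simp add: ennreal_powr_mult sum_distrib_left ac_simps)
  also have "\<dots> \<le> ennreal_powr M q0 * ennreal_powr (?normX g) q0"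
    by (intro mult_left_mono N0_le) simp
  finally have "ennreal_powr (?normY (T g)) q0 \<le> K * (ennreal_powr M q0 * ennreal_powr (?normX g) q0)"
    by (simp add: mult_left_mono)
  then have "?normY (T g) \<le> ennreal_powr (K * (ennreal_powr M q0 * ennreal_powr (?normX g) q0)) (1 / q0)"
    using q0(1) by (simp add: ennreal_powr_le_iff)
  also have "\<dots> = ennreal_powr K (1 / q0) * M * ?normX g"
    using q0(1) by (simp add: ennreal_powr_mult ennreal_powr_powr mult.assoc)
  finally show ?thesis .
qed

text \<open>The two sides of the limit are treated differently: the norm on \<open>Y\<close>
  commutes with the increasing limit of \<open>\<bar>T (fs n)\<bar>\<close>, while on
  \<open>X\<close> the bound \<open>\<bar>fs n\<bar> \<le> \<bar>f\<bar>\<close> suffices.\<close>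

lemma restricted_type_sup_le:
  fixes X :: "'a measure" and Y :: "'b measure" and T :: "('a \<Rightarrow> real) \<Rightarrow> 'b \<Rightarrow> real"
    and q1 :: ennreal
  assumes L: "regular_class X L" and T: "T \<in> L \<rightarrow> measurable_functions Y"
    and oc: "order_continuous_op X L Y T" and sub: "sublinear_op L Y T"
    and q0: "0 < q0" "q0 \<le> 1" and "0 < q1" and "0 < K"
    and quasi: "\<And>(J :: nat set) h. finite J \<Longrightarrow> (\<And>j. j \<in> J \<Longrightarrow> h j \<in> borel_measurable Y) \<Longrightarrow>
      lorentz_norm Y (p1 / q0) (q1 / ennreal q0) (\<lambda>y. \<Sum>j\<in>J. h j y)
        \<le> ennreal K * (\<Sum>j\<in>J. lorentz_norm Y (p1 / q0) (q1 / ennreal q0) (h j))"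
  shows "(SUP f\<in>L. lorentz_norm Y p1 q1 (T f) / lorentz_norm X p0 (ennreal q0) f)
    \<le> ennreal (K powr (1 / q0)) *
      (SUP B\<in>{B \<in> sets X. indicator B \<in> L}.
        lorentz_norm Y p1 q1 (T (indicator B)) / lorentz_norm X p0 (ennreal q0) (indicator B))"
    (is "_ \<le> _ * ?M")
proof (cases "?M = top")
  case True
  then show ?thesis unfolding True using \<open>0 < K\<close> by (simp add: ennreal_mult_top)
next
  case False
  let ?normX = "lorentz_norm X p0 (ennreal q0)" and ?normY = "lorentz_norm Y p1 q1"
  have mono: "monotone_op X L Y T" using oc by (simp add: order_continuous_op_def)
  have T_meas: "T f \<in> borel_measurable Y" if "f \<in> L" for f
    using T that by (auto simp: measurable_functions_def)
  have L_meas: "f \<in> borel_measurable X" if "f \<in> L" for f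
    using L that by (auto simp: regular_class_def measurable_functions_def)
  have restricted: "?normY (T (indicator B)) \<le> ?M * ?normX (indicator B)"
    if "B \<in> sets X" "indicator B \<in> L" "?normX (indicator B) < top" for B
    using that False by (intro ennreal_le_mult_if_divide_le SUP_upper) (auto simp: less_top[symmetric])
  have strong: "?normY (T f) \<le> ennreal (K powr (1 / q0)) * ?M * ?normX f" if f: "f \<in> L" "?normX f < top" for f
  proof -
    have abs_f: "(\<lambda>x. \<bar>f x\<bar>) \<in> L" by (rule regular_class_abs[OF L f(1)])
    obtain fs :: "nat \<Rightarrow> 'a \<Rightarrow> real" where fs: "\<And>n. fs n \<in> L" "\<And>n. simple_function X (fs n)"
      and fs_lim: "AE x in X. (\<forall>n. 0 \<le> fs n x \<and> fs n x \<le> fs (Suc n) x) \<and> (\<lambda>n. fs n x) \<longlonglongrightarrow> \<bar>f x\<bar>"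
      by (rule regular_class_approx[OF L f(1)]) blast
    have fs_le: "AE x in X. \<bar>fs n x\<bar> \<le> \<bar>f x\<bar>" for n
      using fs_lim
    proof eventually_elim
      case (elim x)
      have "incseq (\<lambda>n. fs n x)" using elim by (intro incseq_SucI) blast
      then have "fs n x \<le> \<bar>f x\<bar>" by (rule incseq_le[OF _ conjunct2[OF elim]])
      moreover have "0 \<le> fs n x" using elim by blast
      ultimately show ?case by simp
    qed
    have lim: "AE y in Y. (\<lambda>n. \<bar>T (fs n) y\<bar>) \<longlonglongrightarrow> \<bar>T (\<lambda>x. \<bar>f x\<bar>) y\<bar>"
      by (rule order_continuous_opD[OF oc abs_f fs(1) fs_lim])
    have "AE x in X. \<bar>fs n x\<bar> \<le> \<bar>fs (Suc n) x\<bar>" for n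
      using fs_lim
    proof eventually_elim
      case (elim x)
      then have "0 \<le> fs n x" "fs n x \<le> fs (Suc n) x" by blast+
      then show ?case by simp
    qed
    then have T_mono: "AE y in Y. \<bar>T (fs n) y\<bar> \<le> \<bar>T (fs (Suc n)) y\<bar>" for n
      by (intro monotone_opD[OF mono] fs(1))
    \<comment> \<open>The approximants converge to \<open>\<bar>f\<bar>\<close>, so order continuity
      reaches only \<open>T \<bar>f\<bar>\<close>; monotonicity compares it with
      \<open>T f\<close>.\<close>
    have "?normY (T f) \<le> ?normY (T (\<lambda>x. \<bar>f x\<bar>))"
      by (intro lorentz_norm_mono T_meas f(1) abs_f monotone_opD[OF mono]) simp
    also have "\<dots> = (SUP n. ?normY (T (fs n)))"
      using fs(1) abs_f by (intro lorentz_norm_SUP \<open>0 < q1\<close> T_meas T_mono lim)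
    also have "\<dots> \<le> ennreal (K powr (1 / q0)) * ?M * ?normX f"
    proof (rule SUP_least)
      fix n
      have le: "?normX (fs n) \<le> ?normX f"
        using fs_le fs(1) f(1) by (intro lorentz_norm_mono L_meas)
      then have "?normY (T (fs n)) \<le> ennreal_powr (ennreal K) (1 / q0) * ?M * ?normX (fs n)"
        using f(2)
        by (intro restricted_type_simple[OF L T mono sub q0 \<open>0 < q1\<close> quasi restricted fs]) auto
      also have "\<dots> \<le> ennreal (K powr (1 / q0)) * ?M * ?normX f"
        using \<open>0 < K\<close> le by (simp add: mult_left_mono)
      finally show "?normY (T (fs n)) \<le> ennreal (K powr (1 / q0)) * ?M * ?normX f" .
    qed
    finally show ?thesis .
  qed
  show ?thesis
    by (intro SUP_least ennreal_divide_le_if_le_mult strong)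
qed

theorem theorem1p2p11:
  fixes X :: "'a measure" and Y :: "'b measure"
    and L :: "('a \<Rightarrow> real) set"
    and T :: "('a \<Rightarrow> real) \<Rightarrow> 'b \<Rightarrow> real"
    and p0 q0 :: real
  assumes "sigma_finite_measure X" and "sigma_finite_measure Y"
    and "regular_class X L"
    and "T \<in> L \<rightarrow> measurable_functions Y"
    and "order_continuous_op X L Y T"
    and "sublinear_op L Y T"
    and "0 < q0" and "q0 \<le> 1" and "0 < p0"
  shows
    "(\<forall>p1 q1 :: real. q0 \<le> q1 \<longrightarrow> q1 \<le> p1 \<longrightarrow>
       (SUP f\<in>L. lorentz_norm Y p1 (ennreal q1) (T f) / lorentz_norm X p0 (ennreal q0) f) =
       (SUP B\<in>{B \<in> sets X. indicator B \<in> L}.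
          lorentz_norm Y p1 (ennreal q1) (T (indicator B))
          / lorentz_norm X p0 (ennreal q0) (indicator B)))
     \<and>
     (\<forall>(p1 :: real) (q1 :: ennreal). q0 < p1 \<longrightarrow> ennreal p1 < q1 \<longrightarrow>
       (SUP f\<in>L. lorentz_norm Y p1 q1 (T f) / lorentz_norm X p0 (ennreal q0) f) \<le>
       ennreal ((p1 / (p1 - q0)) powr (1 / q0)) *
       (SUP B\<in>{B \<in> sets X. indicator B \<in> L}.
          lorentz_norm Y p1 q1 (T (indicator B))
          / lorentz_norm X p0 (ennreal q0) (indicator B)))"
proof (intro conjI allI impI)
  note bound = restricted_type_sup_le[OF assms(3-8)]
  {
    fix p1 q1 :: real assume pq: "q0 \<le> q1" "q1 \<le> p1"
    let ?r = "\<lambda>f. lorentz_norm Y p1 (ennreal q1) (T f) / lorentz_norm X p0 (ennreal q0) f"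
    \<comment> \<open>Division by \<open>q0\<close> moves the exponents into the range of the
      genuine triangle inequality, so the constant is \<open>K = 1\<close>.\<close>
    have "1 \<le> q1 / q0" "q1 / q0 \<le> p1 / q0" using pq \<open>0 < q0\<close> by (simp_all add: divide_right_mono)
    moreover have "ennreal q1 / ennreal q0 = ennreal (q1 / q0)"
      using pq \<open>0 < q0\<close> by (simp add: divide_ennreal)
    ultimately have "(SUP f\<in>L. ?r f) \<le> ennreal (1 powr (1 / q0)) * (SUP B\<in>{B \<in> sets X. indicator B \<in> L}. ?r (indicator B))"
      using pq \<open>0 < q0\<close> by (intro bound) (auto intro: lorentz_norm_sum_le[OF assms(2)])
    moreover have "(SUP B\<in>{B \<in> sets X. indicator B \<in> L}. ?r (indicator B)) \<le> (SUP f\<in>L. ?r f)"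
      by (intro SUP_least SUP_upper) simp
    ultimately show "(SUP f\<in>L. ?r f) = (SUP B\<in>{B \<in> sets X. indicator B \<in> L}. ?r (indicator B))"
      by (intro antisym) simp_all
  }
  fix p1 :: real and q1 :: ennreal assume pq: "q0 < p1" "ennreal p1 < q1"
  have "ennreal q0 \<le> q1"
    using pq ennreal_leI[of q0 p1] by (auto intro: order_trans less_imp_le)
  then have "ennreal q0 / ennreal q0 \<le> q1 / ennreal q0" by (rule divide_right_mono_ennreal)
  then have q: "1 \<le> q1 / ennreal q0" using \<open>0 < q0\<close> by simp
  have p: "1 < p1 / q0" using pq(1) \<open>0 < q0\<close> by simp
  \<comment> \<open>Hardy's constant at the exponent \<open>p1 / q0\<close>.\<close>
  have K: "p1 / (p1 - q0) = (p1 / q0) / (p1 / q0 - 1)"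
    using pq(1) \<open>0 < q0\<close> by (simp add: field_simps)
  have "0 < r / (r - 1)" if "1 < r" for r :: real using that by simp
  from this[OF p] have "0 < (p1 / q0) / (p1 / q0 - 1)" .
  moreover have "0 < q1" using pq(2) by (rule order_le_less_trans[rotated]) simp
  ultimately show "(SUP f\<in>L. lorentz_norm Y p1 q1 (T f) / lorentz_norm X p0 (ennreal q0) f) \<le>
       ennreal ((p1 / (p1 - q0)) powr (1 / q0)) *
       (SUP B\<in>{B \<in> sets X. indicator B \<in> L}.
          lorentz_norm Y p1 q1 (T (indicator B))
          / lorentz_norm X p0 (ennreal q0) (indicator B))"
    unfolding K by (intro bound lorentz_norm_sum_quasi[OF assms(2) p q])
qed

end
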